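(* Let $p\ne2$ be a prime, let $n$ be a positive integer, and let $a,b\in\mathbb{Z}_p$ be roots of unity such that $b^n=a^{-n}$. Then for all integers $e\ge1$, $$|T_{a,b,e}|=|T_{a,b,1}|\cdot\begin{cases} p^{e-1}&\text{if } e\le v_p(n)\text{ and } b^n\ne-1,\\ p^{\lfloor (e+v_p(n))/2\rfloor}&\text{if } e\ge v_p(n)+1\text{ and } b^n\neq-1,\\ p^{e-1}&\text{if } e\le 2v_p(n)\text{ and } b^n=-1,\\ p^{\lfloor (e+v_p(n))/3\rfloor+\lfloor (e+v_p(n)+1)/3\rfloor}&\text{if } e\ge 2v_p(n)+1\text{ and } b^n=-1, \end{cases}$$ and $|T_{a,b,\infty}|=|T_{a,b,1}|$.
   Context: Here $p$ is an odd prime. $\mathbb{Z}_p$ is the ring of $p$-adic integers, $v_p$ the $p$-adic valuation. For $x\in\mathbb{Z}_p^\times$, $\omega(x)$ is the Teichmüller representative of $x$ (the unique $(p-1)$-th root of unity in $\mathbb{Z}_p$ congruent to $x$ modulo $p$), and $\langle x\rangle=x/\omega(x)\in 1+p\mathbb{Z}_p$; for $z\in\mathbb{Z}_p$, $\langle x\rangle^{z}=\exp(z\log\langle x\rangle)$. For $a,b\in\mathbb{Z}_p$ and $e\ge1$, $T_{a,b,e}$ is the set of pairs of integers $(x,y)$ with $1\le x,y\le p^e(p-1)$, $p\nmid x$, $p\nmid y$, $x\equiv a\pmod p$, $y\equiv b\pmod p$, and $x^{x^n}\equiv y\pmod{p^e}$, $y^{y^n}\equiv x\pmod{p^e}$.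 $T_{a,b,\infty}$ is the set of $(x,y,x_0,y_0)\in\mathbb{Z}_p^2\times\{1,\dots,p-1\}^2$ with $p\nmid x$, $p\nmid y$, $x\equiv a\pmod p$, $y\equiv b\pmod p$, and $\omega(x)^{x_0^n}\langle x\rangle^{x^n}=y$, $\omega(y)^{y_0^n}\langle y\rangle^{y^n}=x$. *)

theory Defs
  imports "HOL-Analysis.Analysis" "Berlekamp_Zassenhaus.Finite_Field"
begin

text \<open>
  The prime is \<open>p = CARD('p)\<close> for a type \<open>'p\<close> of class \<^class>\<open>prime_card\<close>, and the \<open>p\<close>-adic
  integers are the inverse limit of the rings \<open>\<int>/p\<^sup>k\<int>\<close>, whose elements are given by their
  representatives in \<open>{0..<p\<^sup>k}\<close> (the condition below forces the entries into that range).
\<close>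

typedef (overloaded) 'p padic_int =
  "{s :: nat \<Rightarrow> int. \<forall>k. s (Suc k) mod int CARD('p::prime_card) ^ k = s k}"
  by (rule exI[of _ "\<lambda>_. 0"]) simp

setup_lifting type_definition_padic_int

lemma padic_coherent_mod:
  assumes "\<And>k. s (Suc k) mod (q::int) ^ k = s k" and "m \<le> k"
  shows "s k mod q ^ m = s m"
  using assms(2)
proof (induction k rule: dec_induct)
  case base
  show ?case using assms(1)[of m] by (metis mod_mod_trivial)
next
  case (step k)
  have "s (Suc k) mod q ^ m = (s (Suc k) mod q ^ k) mod q ^ m"
    using step.hyps by (simp add: mod_mod_cancel le_imp_power_dvd)
  also have "\<dots> = s m" using step.IH assms(1)[of k] by simp
  finally show ?case .
qed

lemma Rep_padic_int_mod:
  fixes x :: "'p::prime_card padic_int"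
  assumes "m \<le> k"
  shows "Rep_padic_int x k mod int CARD('p) ^ m = Rep_padic_int x m"
  by (rule padic_coherent_mod[of "Rep_padic_int x"]) (use Rep_padic_int[of x] assms in auto)

lemma Rep_padic_int_mod_Suc [simp]:
  fixes x :: "'p::prime_card padic_int"
  shows "Rep_padic_int x (Suc k) mod int CARD('p) ^ k = Rep_padic_int x k"
  by (rule Rep_padic_int_mod) simp

lemma Rep_padic_int_mod_self [simp]:
  fixes x :: "'p::prime_card padic_int"
  shows "Rep_padic_int x k mod int CARD('p) ^ k = Rep_padic_int x k"
  by (rule Rep_padic_int_mod) simp

lemma padic_coherent_add:
  fixes q :: int
  assumes "\<And>k. x (Suc k) mod q ^ k = x k" and "\<And>k. y (Suc k) mod q ^ k = y k"
  shows "(x (Suc k) + y (Suc k)) mod q ^ Suc k mod q ^ k = (x k + y k) mod q ^ k"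
proof -
  have m: "z (Suc k) mod q ^ k = z k mod q ^ k" if "z (Suc k) mod q ^ k = z k" for z
    by (subst that[symmetric]) (rule mod_mod_trivial[symmetric])
  have "(x (Suc k) + y (Suc k)) mod q ^ Suc k mod q ^ k = (x (Suc k) + y (Suc k)) mod q ^ k"
    by (rule mod_mod_cancel) simp
  also have "\<dots> = (x k + y k) mod q ^ k"
    by (rule mod_add_cong[OF m[OF assms(1)] m[OF assms(2)]])
  finally show "(x (Suc k) + y (Suc k)) mod q ^ Suc k mod q ^ k = (x k + y k) mod q ^ k" .
qed

lemma padic_coherent_diff:
  fixes q :: int
  assumes "\<And>k. x (Suc k) mod q ^ k = x k" and "\<And>k. y (Suc k) mod q ^ k = y k"
  shows "(x (Suc k) - y (Suc k)) mod q ^ Suc k mod q ^ k = (x k - y k) mod q ^ k"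
proof -
  have m: "z (Suc k) mod q ^ k = z k mod q ^ k" if "z (Suc k) mod q ^ k = z k" for z
    by (subst that[symmetric]) (rule mod_mod_trivial[symmetric])
  have "(x (Suc k) - y (Suc k)) mod q ^ Suc k mod q ^ k = (x (Suc k) - y (Suc k)) mod q ^ k"
    by (rule mod_mod_cancel) simp
  also have "\<dots> = (x k - y k) mod q ^ k"
    by (rule mod_diff_cong[OF m[OF assms(1)] m[OF assms(2)]])
  finally show "(x (Suc k) - y (Suc k)) mod q ^ Suc k mod q ^ k = (x k - y k) mod q ^ k" .
qed

lemma padic_coherent_minus:
  fixes q :: int
  assumes "\<And>k. x (Suc k) mod q ^ k = x k"
  shows "(- x (Suc k)) mod q ^ Suc k mod q ^ k = (- x k) mod q ^ k"
proof -
  have m: "z (Suc k) mod q ^ k = z k mod q ^ k" if "z (Suc k) mod q ^ k = z k" for z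
    by (subst that[symmetric]) (rule mod_mod_trivial[symmetric])
  have "(- x (Suc k)) mod q ^ Suc k mod q ^ k = (- x (Suc k)) mod q ^ k"
    by (rule mod_mod_cancel) simp
  also have "\<dots> = (- x k) mod q ^ k"
    by (rule mod_minus_cong[OF m[OF assms]])
  finally show "(- x (Suc k)) mod q ^ Suc k mod q ^ k = (- x k) mod q ^ k" .
qed

lemma padic_coherent_mult:
  fixes q :: int
  assumes "\<And>k. x (Suc k) mod q ^ k = x k" and "\<And>k. y (Suc k) mod q ^ k = y k"
  shows "(x (Suc k) * y (Suc k)) mod q ^ Suc k mod q ^ k = (x k * y k) mod q ^ k"
proof -
  have m: "z (Suc k) mod q ^ k = z k mod q ^ k" if "z (Suc k) mod q ^ k = z k" for z
    by (subst that[symmetric]) (rule mod_mod_trivial[symmetric])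
  have "(x (Suc k) * y (Suc k)) mod q ^ Suc k mod q ^ k = (x (Suc k) * y (Suc k)) mod q ^ k"
    by (rule mod_mod_cancel) simp
  also have "\<dots> = (x k * y k) mod q ^ k"
    by (rule mod_mult_cong[OF m[OF assms(1)] m[OF assms(2)]])
  finally show "(x (Suc k) * y (Suc k)) mod q ^ Suc k mod q ^ k = (x k * y k) mod q ^ k" .
qed

instantiation padic_int :: (prime_card) comm_ring_1
begin

lift_definition zero_padic_int :: "'a padic_int" is "\<lambda>_. 0" by simp

lift_definition one_padic_int :: "'a padic_int" is "\<lambda>k. 1 mod int CARD('a) ^ k"
  by (rule mod_mod_cancel) simp

lift_definition plus_padic_int :: "'a padic_int \<Rightarrow> 'a padic_int \<Rightarrow> 'a padic_int"
  is "\<lambda>x y k. (x k + y k) mod int CARD('a) ^ k"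
  subgoal premises prems for x y k by (rule padic_coherent_add[of x "int CARD('a)" y k, OF prems])
  done

lift_definition minus_padic_int :: "'a padic_int \<Rightarrow> 'a padic_int \<Rightarrow> 'a padic_int"
  is "\<lambda>x y k. (x k - y k) mod int CARD('a) ^ k"
  subgoal premises prems for x y k by (rule padic_coherent_diff[of x "int CARD('a)" y k, OF prems])
  done

lift_definition uminus_padic_int :: "'a padic_int \<Rightarrow> 'a padic_int"
  is "\<lambda>x k. (- x k) mod int CARD('a) ^ k"
  subgoal premises prems for x k by (rule padic_coherent_minus[of x "int CARD('a)" k, OF prems])
  done

lift_definition times_padic_int :: "'a padic_int \<Rightarrow> 'a padic_int \<Rightarrow> 'a padic_int"
  is "\<lambda>x y k. (x k * y k) mod int CARD('a) ^ k"
  subgoal premises prems for x y k by (rule padic_coherent_mult[of x "int CARD('a)" y k, OF prems])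
  done

instance
proof
  fix a b c :: "'a padic_int"
  have red: "s k mod int CARD('a) ^ k = s k"
    if "\<And>k. s (Suc k) mod int CARD('a) ^ k = s k" for s k
    using padic_coherent_mod[OF that, of k k] by simp
  show "a + b + c = a + (b + c)" by transfer (simp add: mod_simps ac_simps)
  show "a + b = b + a" by transfer (simp add: ac_simps)
  show "0 + a = a" by transfer (auto simp: red)
  show "- a + a = 0" by transfer (simp add: mod_simps)
  show "a - b = a + - b" by transfer (simp add: mod_simps)
  show "a * b * c = a * (b * c)" by transfer (simp add: mod_simps ac_simps)
  show "a * b = b * a" by transfer (simp add: ac_simps)
  show "1 * a = a" by transfer (auto simp: mod_simps red)
  show "(a + b) * c = a * c + b * c" by transfer (simp add: mod_simps algebra_simps)
  have "1 < int CARD('a)" using prime_card_int[where 'a='a] prime_gt_1_int by blast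
  then have "Rep_padic_int (0 :: 'a padic_int) 1 \<noteq> Rep_padic_int (1 :: 'a padic_int) 1"
    by (simp add: zero_padic_int.rep_eq one_padic_int.rep_eq)
  then show "(0 :: 'a padic_int) \<noteq> 1" by auto
qed

end

lemma Rep_padic_int_of_nat:
  "Rep_padic_int (of_nat m :: 'p::prime_card padic_int) k = int m mod int CARD('p) ^ k"
  by (induction m) (simp_all add: zero_padic_int.rep_eq one_padic_int.rep_eq plus_padic_int.rep_eq
      mod_simps ac_simps)

lemma Rep_padic_int_0 [simp]: "Rep_padic_int x 0 = 0"
  using Rep_padic_int_mod_self[of x 0] by simp

lemma padic_int_nonzero_component:
  fixes x :: "'p::prime_card padic_int"
  assumes "x \<noteq> 0"
  obtains i where "i > 0" "\<And>k. k \<ge> i \<Longrightarrow> \<not> int CARD('p) ^ i dvd Rep_padic_int x k"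
proof -
  obtain i where i: "Rep_padic_int x i \<noteq> 0"
    using assms by (metis Rep_padic_int_inject zero_padic_int.rep_eq ext)
  then have "i > 0" by (cases i) auto
  moreover have "\<not> int CARD('p) ^ i dvd Rep_padic_int x k" if "k \<ge> i" for k
    using i Rep_padic_int_mod[OF that, of x] by (metis dvd_imp_mod_0)
  ultimately show thesis using that by blast
qed

instance padic_int :: (prime_card) idom
proof
  fix x y :: "'a padic_int"
  let ?p = "int CARD('a)"
  assume "x \<noteq> 0" "y \<noteq> 0"
  obtain i where i: "\<And>k. k \<ge> i \<Longrightarrow> \<not> ?p ^ i dvd Rep_padic_int x k"
    using padic_int_nonzero_component[OF \<open>x \<noteq> 0\<close>] by metis
  obtain j where j: "\<And>k. k \<ge> j \<Longrightarrow> \<not> ?p ^ j dvd Rep_padic_int y k"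
    using padic_int_nonzero_component[OF \<open>y \<noteq> 0\<close>] by metis
  let ?a = "Rep_padic_int x (i + j)" and ?b = "Rep_padic_int y (i + j)"
  have p: "prime ?p" by (rule prime_card_int)
  have na: "\<not> ?p ^ i dvd ?a" and nb: "\<not> ?p ^ j dvd ?b" using i j by auto
  have nu: "\<not> is_unit ?p" using p not_prime_unit by blast
  from na nb have nz: "?a \<noteq> 0" "?b \<noteq> 0" by auto
  have "multiplicity ?p ?a < i" "multiplicity ?p ?b < j"
    using multiplicity_lessI[OF nz(1) nu na] multiplicity_lessI[OF nz(2) nu nb] by auto
  then have "multiplicity ?p (?a * ?b) < i + j"
    using p nz by (simp add: prime_elem_multiplicity_mult_distrib)
  then have "\<not> ?p ^ (i + j) dvd ?a * ?b"
    using p nz by (subst power_dvd_iff_le_multiplicity) auto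
  then have "Rep_padic_int (x * y) (i + j) \<noteq> 0"
    by (simp add: times_padic_int.rep_eq dvd_eq_mod_eq_0)
  then show "x * y \<noteq> 0" by (auto simp: zero_padic_int.rep_eq)
qed

instance padic_int :: (prime_card) ring_char_0
proof
  show "inj (of_nat :: nat \<Rightarrow> 'a padic_int)"
  proof (rule injI)
    fix m n :: nat
    assume eq: "(of_nat m :: 'a padic_int) = of_nat n"
    have p: "1 < CARD('a)" using prime_card[where 'a='a] prime_gt_1_nat by blast
    let ?k = "max m n"
    have "?k < CARD('a) ^ ?k" using p by (intro power_gt_expt) simp
    then have lt: "m < CARD('a) ^ ?k" "n < CARD('a) ^ ?k" by auto
    have "int (m mod CARD('a) ^ ?k) = int (n mod CARD('a) ^ ?k)"
      using Rep_padic_int_of_nat[of m ?k, where 'p='a] Rep_padic_int_of_nat[of n ?k, where 'p='a] eq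
      by (simp only: of_nat_mod of_nat_power)
    then show "m = n" using lt by simp
  qed
qed

text \<open>
  Exact division. Whenever the quotient in \<open>\<rat>\<^sub>p\<close> lies in \<open>\<int>\<^sub>p\<close>, it is \<^term>\<open>x div y\<close>.
\<close>

instantiation padic_int :: (prime_card) idom_divide
begin

definition divide_padic_int :: "'a padic_int \<Rightarrow> 'a padic_int \<Rightarrow> 'a padic_int" where
  "divide_padic_int x y = (if y \<noteq> 0 \<and> y dvd x then THE z. x = z * y else 0)"

instance
proof
  fix a b :: "'a padic_int"
  show "a * b div b = a" if "b \<noteq> 0"
    unfolding divide_padic_int_def using that by (auto intro!: the_equality)
  show "a div 0 = 0" by (simp add: divide_padic_int_def)
qed

end

definition padic_val :: "'p::prime_card padic_int \<Rightarrow> nat" where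
  "padic_val x = Max {k. of_nat CARD('p) ^ k dvd x}"

definition padic_abs :: "'p::prime_card padic_int \<Rightarrow> real" where
  "padic_abs x = (if x = 0 then 0 else 1 / real CARD('p) ^ padic_val x)"

lemma finite_padic_powers_dvd:
  fixes x :: "'p::prime_card padic_int"
  assumes "x \<noteq> 0"
  shows "finite {k. of_nat CARD('p) ^ k dvd x}"
proof -
  obtain i where i: "\<And>k. k \<ge> i \<Longrightarrow> \<not> int CARD('p) ^ i dvd Rep_padic_int x k"
    using padic_int_nonzero_component[OF assms] by metis
  have "k < i" if dvd: "of_nat CARD('p) ^ k dvd x" for k
  proof (rule ccontr)
    assume "\<not> k < i"
    then have k: "i \<le> k" by simp
    obtain z where z: "x = of_nat CARD('p) ^ k * z" using dvd by (rule dvdE)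
    have "Rep_padic_int (of_nat CARD('p) ^ k :: 'p padic_int) k = int CARD('p) ^ k mod int CARD('p) ^ k"
      using Rep_padic_int_of_nat[of "CARD('p) ^ k" k, where 'p='p] by (simp only: of_nat_power)
    then have "Rep_padic_int x k = 0"
      unfolding z times_padic_int.rep_eq by (simp only: mod_self mult_zero_left mod_0)
    then show False using i[OF k] by simp
  qed
  then have "{k. of_nat CARD('p) ^ k dvd x} \<subseteq> {..<i}" by blast
  then show ?thesis by (rule finite_subset) simp
qed

lemma padic_abs_le_iff_dvd:
  fixes x :: "'p::prime_card padic_int"
  shows "padic_abs x \<le> 1 / real CARD('p) ^ k \<longleftrightarrow> of_nat CARD('p) ^ k dvd x"
proof (cases "x = 0")
  case False
  have p: "1 < real CARD('p)" using prime_card[where 'a='p] prime_gt_1_nat by auto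
  let ?K = "{k. of_nat CARD('p) ^ k dvd x}"
  have fin: "finite ?K" by (rule finite_padic_powers_dvd[OF False])
  have "0 \<in> ?K" by simp
  then have "?K \<noteq> {}" by blast
  with fin have "Max ?K \<in> ?K" by (rule Max_in)
  then have "k \<le> padic_val x \<longleftrightarrow> of_nat CARD('p) ^ k dvd x"
    using fin unfolding padic_val_def by (auto intro: Max_ge power_le_dvd)
  then show ?thesis
    using False p by (simp add: padic_abs_def divide_simps)
qed (simp add: padic_abs_def)

lemma padic_abs_add_le: "padic_abs (x + y) \<le> max (padic_abs x) (padic_abs y)"
  for x y :: "'p::prime_card padic_int"
proof (cases "x = 0 \<or> y = 0")
  case False
  obtain i j where ij: "padic_abs x = 1 / real CARD('p) ^ i" "padic_abs y = 1 / real CARD('p) ^ j"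
    using False unfolding padic_abs_def by auto
  let ?m = "min i j"
  have p: "1 < real CARD('p)" using prime_card[where 'a='p] prime_gt_1_nat by auto
  have m: "1 / real CARD('p) ^ ?m = max (padic_abs x) (padic_abs y)"
  proof (cases "i \<le> j")
    case True
    then have "1 / real CARD('p) ^ j \<le> 1 / real CARD('p) ^ i"
      using p by (intro divide_left_mono power_increasing) auto
    with True show ?thesis unfolding ij by (simp only: min_absorb1 max_absorb1)
  next
    case False
    then have "j \<le> i" by simp
    then have "1 / real CARD('p) ^ i \<le> 1 / real CARD('p) ^ j"
      using p by (intro divide_left_mono power_increasing) auto
    with \<open>j \<le> i\<close> show ?thesis unfolding ij by (simp only: min_absorb2 max_absorb2)
  qed
  have "of_nat CARD('p) ^ ?m dvd x" "of_nat CARD('p) ^ ?m dvd y"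
    by (simp_all only: padic_abs_le_iff_dvd[symmetric] m max.cobounded1 max.cobounded2)
  then have "of_nat CARD('p) ^ ?m dvd x + y" by (rule dvd_add)
  then show ?thesis by (simp only: padic_abs_le_iff_dvd[symmetric] m)
qed (auto simp: padic_abs_def)

instantiation padic_int :: (prime_card) metric_space
begin

definition dist_padic_int :: "'a padic_int \<Rightarrow> 'a padic_int \<Rightarrow> real" where
  "dist x y = padic_abs (x - y)"

definition uniformity_padic_int :: "('a padic_int \<times> 'a padic_int) filter" where
  "uniformity_padic_int = (INF e\<in>{0<..}. principal {(x, y). dist x y < e})"

definition open_padic_int :: "'a padic_int set \<Rightarrow> bool" where
  "open_padic_int U = (\<forall>x\<in>U. eventually (\<lambda>(x', y). x' = x \<longrightarrow> y \<in> U) uniformity)"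

instance
proof
  have nonneg: "padic_abs z \<ge> 0" for z :: "'a padic_int"
    by (simp add: padic_abs_def)
  have minus: "padic_abs (- z) = padic_abs z" for z :: "'a padic_int"
    by (simp add: padic_abs_def padic_val_def)
  fix x y z :: "'a padic_int"
  show "dist x y = 0 \<longleftrightarrow> x = y" by (simp add: dist_padic_int_def padic_abs_def)
  show "dist x y \<le> dist x z + dist y z"
    using padic_abs_add_le[of "x - z" "z - y"] nonneg[of "x - z"] nonneg[of "y - z"] minus[of "y - z"]
    by (simp add: dist_padic_int_def)
qed (simp_all add: uniformity_padic_int_def open_padic_int_def)

end

text \<open>
  For odd \<open>p\<close> and \<open>p dvd x\<close> all the terms \<open>x\<^sup>k / k!\<close> and \<open>x\<^sup>k / k\<close> lie in \<open>\<int>\<^sub>p\<close> and tend to 0, so that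
  with exact division and the \<open>p\<close>-adic topology the two series below are the usual \<open>p\<close>-adic
  exponential on \<open>p\<int>\<^sub>p\<close> and logarithm on \<open>1 + p\<int>\<^sub>p\<close>. They are only used on these domains.
\<close>

definition padic_exp :: "'p::prime_card padic_int \<Rightarrow> 'p padic_int" where
  "padic_exp x = (\<Sum>k. x ^ k div fact k)"

definition padic_log :: "'p::prime_card padic_int \<Rightarrow> 'p padic_int" where
  "padic_log x = (\<Sum>k. (- 1) ^ k * (x - 1) ^ Suc k div of_nat (Suc k))"

definition teichmuller :: "'p::prime_card padic_int \<Rightarrow> 'p padic_int" where
  "teichmuller x = (THE w. w ^ (CARD('p) - 1) = 1 \<and> of_nat CARD('p) dvd w - x)"

definition padic_angle :: "'p::prime_card padic_int \<Rightarrow> 'p padic_int" where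
  "padic_angle x = x div teichmuller x"

definition padic_angle_pow :: "'p::prime_card padic_int \<Rightarrow> 'p padic_int \<Rightarrow> 'p padic_int" where
  "padic_angle_pow x z = padic_exp (z * padic_log (padic_angle x))"

definition root_of_unity :: "'a::monoid_mult \<Rightarrow> bool" where
  "root_of_unity a \<longleftrightarrow> (\<exists>m>0. a ^ m = 1)"

definition T_fin ::
  "nat \<Rightarrow> 'p::prime_card padic_int \<Rightarrow> 'p padic_int \<Rightarrow> nat \<Rightarrow> (nat \<times> nat) set" where
  "T_fin n a b e = {(x, y).
     x \<in> {1..CARD('p) ^ e * (CARD('p) - 1)} \<and> y \<in> {1..CARD('p) ^ e * (CARD('p) - 1)} \<and>
     \<not> CARD('p) dvd x \<and> \<not> CARD('p) dvd y \<and>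
     of_nat CARD('p) dvd of_nat x - a \<and> of_nat CARD('p) dvd of_nat y - b \<and>
     [x ^ (x ^ n) = y] (mod CARD('p) ^ e) \<and> [y ^ (y ^ n) = x] (mod CARD('p) ^ e)}"

definition T_inf ::
  "nat \<Rightarrow> 'p::prime_card padic_int \<Rightarrow> 'p padic_int \<Rightarrow>
     ('p padic_int \<times> 'p padic_int \<times> nat \<times> nat) set" where
  "T_inf n a b = {(x, y, x0, y0).
     x0 \<in> {1..CARD('p) - 1} \<and> y0 \<in> {1..CARD('p) - 1} \<and>
     \<not> of_nat CARD('p) dvd x \<and> \<not> of_nat CARD('p) dvd y \<and>
     of_nat CARD('p) dvd x - a \<and> of_nat CARD('p) dvd y - b \<and>
     teichmuller x ^ (x0 ^ n) * padic_angle_pow x (x ^ n) = y \<and>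
     teichmuller y ^ (y0 ^ n) * padic_angle_pow y (y ^ n) = x}"

end

theory Submission
  imports Defs
begin

text \<open>
  Fermat's little theorem in \<open>\<int>\<^sub>p\<close> together with the absence of torsion in \<open>1 + p\<int>\<^sub>p\<close> (for odd \<open>p\<close>)
  shows that \<open>a\<close> and \<open>b\<close> are \<open>(p - 1)\<close>-th roots of unity, hence the Teichmueller representatives
  of every \<open>x\<close> and \<open>y\<close> in question. Write \<open>x = a s\<close> and \<open>y = b t\<close> with \<open>s, t \<in> 1 + p\<int>\<^sub>p\<close>. The root of
  unity parts of the two equations are \<open>a^(x^n) = b\<close> and \<open>b^(y^n) = a\<close>; they involve
  only the classes \<open>(i, j)\<close> of \<open>x\<close> and \<open>y\<close> modulo \<open>p - 1\<close> or, for \<open>e = \<infinity>\<close>, the components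
  \<open>(x0, y0)\<close> in their place, and cut out the same finite set of pairs, called
  \<open>exponent_pairs\<close> below, for all \<open>e\<close>. By the Chinese remainder theorem
  everything else is a count of the possible \<open>s\<close>.

  For finite \<open>e\<close> the remaining conditions are \<open>s^(x^n) \<equiv> t\<close> and \<open>t^(y^n) \<equiv> s\<close> modulo \<open>p^e\<close>. The first one
  determines \<open>t\<close>. Given the first, the second says \<open>s^((xy)^n - 1) \<equiv> 1\<close>. Three applications of
  lifting the exponent (\<open>s^m - 1\<close> is \<open>m (s - 1)\<close> up to a unit, \<open>lifting_the_exponent\<close>), using
  \<open>(xy)^n = (st)^n\<close>, which is where \<open>(ab)^n = 1\<close> enters, and \<open>st \<equiv> s^(1 + x^n)\<close>, turn this into
  \<open>p^e dvd n (s - 1)^2 (1 + x^n)\<close> (\<open>tetration_congruences_iff\<close>). Here \<open>1 + x^n = 1 + a^n s^n\<close> is a unit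
  unless \<open>a^n = -1\<close>, equivalently \<open>b^n = -1\<close>, and in that case it is \<open>n (s - 1)\<close> up to a unit.
  So the condition bounds \<open>v_p(n) + 2 v_p(s - 1)\<close>, respectively \<open>2 v_p(n) + 3 v_p(s - 1)\<close>, below by
  \<open>e\<close>; that is, \<open>s \<equiv> 1\<close> modulo \<open>p^d\<close> with an explicit \<open>d\<close> between \<open>1\<close> and \<open>e\<close> (\<open>congruence_depth\<close>).
  There are \<open>p^(e - d)\<close> such residues modulo \<open>p^e\<close>, and for \<open>e = 1\<close> there is one.

  For \<open>e = \<infinity>\<close> put \<open>u = log s\<close> and \<open>v = log t\<close>. The equations become \<open>v = x^n u\<close> and \<open>u = y^n v\<close>, so
  \<open>u = 0\<close> or \<open>(st)^n = (xy)^n = 1\<close>. The latter gives \<open>st = 1\<close> and \<open>u + v = 0\<close>, hence \<open>u = 0\<close> or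
  \<open>x^n = -1\<close>; and \<open>a^n s^n = -1\<close> makes \<open>s\<close> a root of unity in \<open>1 + p\<int>\<^sub>p\<close>, so \<open>s = 1\<close>. Thus
  \<open>s = t = 1\<close> always (\<open>exp_log_fixed_point_trivial\<close>) and only the choice of \<open>(i, j)\<close> is left.
  The two deeper facts on the series used here are \<open>log (exp w) = w\<close> and \<open>log s + log t = 0\<close> if \<open>st = 1\<close>.
  Both follow from \<open>log s = lim (s^(p^k) - 1) / p^k\<close> (\<open>padic_log_limit\<close>), the first one with the
  additivity of \<open>exp\<close>.
\<close>

section \<open>Divisibility and completeness in the p-adic integers\<close>

text \<open>
  Hiding \<open>of_nat CARD('p)\<close> behind a constant keeps the simplifier from rewriting powers of \<open>p\<close>
  as casts of natural numbers.
\<close>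

definition uniformizer :: "'p::prime_card padic_int" ("\<pp>") where
  "\<pp> = of_nat CARD('p)"

instance padic_int :: (prime_card) algebraic_semidom ..

lemma card_gt_1: "1 < CARD('p::prime_card)"
  using prime_card[where 'a='p] prime_gt_1_nat by blast

lemma Rep_padic_int_of_int:
  "Rep_padic_int (of_int m :: 'p::prime_card padic_int) k = m mod int CARD('p) ^ k"
  by (cases m rule: int_cases2)
    (simp_all add: uminus_padic_int.rep_eq Rep_padic_int_of_nat mod_minus_eq)

text \<open>
  The interface between divisibility in \<open>\<int>\<^sub>p\<close> and the inverse limit: if the \<open>k\<close>-th entry
  vanishes, then \<open>p^k\<close> divides all later entries, and the shifted sequence of quotients is again coherent.
\<close>

lemma uniformizer_power_dvd_iff:
  fixes x :: "'p::prime_card padic_int"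
  shows "\<pp> ^ k dvd x \<longleftrightarrow> Rep_padic_int x k = 0"
proof
  assume "\<pp> ^ k dvd x"
  then obtain z where z: "x = \<pp> ^ k * z" by (rule dvdE)
  have "Rep_padic_int (\<pp> ^ k :: 'p padic_int) k = 0"
    using Rep_padic_int_of_nat[of "CARD('p) ^ k" k, where 'p='p] by (simp add: uniformizer_def)
  then show "Rep_padic_int x k = 0" by (simp add: z times_padic_int.rep_eq)
next
  let ?q = "int CARD('p)"
  assume 0: "Rep_padic_int x k = 0"
  have q: "?q > 0" using card_gt_1[where 'p='p] by simp
  define z where "z j = Rep_padic_int x (j + k) div ?q ^ k" for j
  have coh: "z (Suc j) mod ?q ^ j = z j" for j
  proof -
    have "z j = (Rep_padic_int x (Suc j + k) mod (?q ^ k * ?q ^ j)) div ?q ^ k"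
      using Rep_padic_int_mod[of "j + k" "Suc j + k" x] by (simp add: z_def power_add mult.commute)
    also have "\<dots> = z (Suc j) mod ?q ^ j"
      using q by (simp add: z_def zmod_zmult2_eq)
    finally show ?thesis by simp
  qed
  then have rep: "Rep_padic_int (Abs_padic_int z :: 'p padic_int) = z"
    by (intro Abs_padic_int_inverse) simp
  have "Rep_padic_int (\<pp> ^ k * Abs_padic_int z :: 'p padic_int) j = Rep_padic_int x j" for j
  proof -
    have pk: "Rep_padic_int (\<pp> ^ k :: 'p padic_int) j = ?q ^ k mod ?q ^ j"
      using Rep_padic_int_of_nat[of "CARD('p) ^ k" j, where 'p='p] by (simp add: uniformizer_def)
    have "?q ^ k dvd Rep_padic_int x (j + k)"
      using 0 Rep_padic_int_mod[of k "j + k" x] by (simp add: dvd_eq_mod_eq_0)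
    then have "?q ^ k * z j = Rep_padic_int x (j + k)" by (simp add: z_def)
    then show ?thesis using Rep_padic_int_mod[of j "j + k" x]
      by (simp add: times_padic_int.rep_eq pk rep mod_mult_left_eq)
  qed
  then have "x = \<pp> ^ k * Abs_padic_int z" by (metis Rep_padic_int_inject ext)
  then show "\<pp> ^ k dvd x" by simp
qed

text \<open>
  Equalities in \<open>\<int>\<^sub>p\<close>, in particular those between values of series, are proved below
  modulo every power of \<open>p\<close>.
\<close>

lemma uniformizer_power_dvd_imp_eq_0:
  fixes x :: "'p::prime_card padic_int"
  assumes "\<And>k. \<pp> ^ k dvd x"
  shows "x = 0"
proof -
  have "Rep_padic_int x = Rep_padic_int (0 :: 'p padic_int)"
    using assms by (auto simp: uniformizer_power_dvd_iff zero_padic_int.rep_eq)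
  then show ?thesis by (simp only: Rep_padic_int_inject)
qed

lemma uniformizer_nonzero [simp]: "(\<pp> :: 'p::prime_card padic_int) \<noteq> 0"
  using card_gt_1[where 'p='p] by (simp add: uniformizer_def)

lemma prime_elem_uniformizer: "prime_elem (\<pp> :: 'p::prime_card padic_int)"
proof (rule prime_elemI)
  show "(\<pp> :: 'p padic_int) \<noteq> 0" by simp
  show "\<not> is_unit (\<pp> :: 'p padic_int)"
    using uniformizer_power_dvd_iff[of 1 "1 :: 'p padic_int"] card_gt_1[where 'p='p]
    by (simp add: one_padic_int.rep_eq)
next
  fix x y :: "'p padic_int"
  assume "\<pp> dvd x * y"
  then have "int CARD('p) dvd Rep_padic_int x 1 * Rep_padic_int y 1"
    using uniformizer_power_dvd_iff[of 1 "x * y"]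
    by (simp add: times_padic_int.rep_eq dvd_eq_mod_eq_0)
  then have "int CARD('p) dvd Rep_padic_int x 1 \<or> int CARD('p) dvd Rep_padic_int y 1"
    using prime_card_int[where 'a='p] by (simp add: prime_dvd_mult_iff)
  then have "Rep_padic_int x 1 = 0 \<or> Rep_padic_int y 1 = 0"
    using Rep_padic_int_mod_self[of x 1] Rep_padic_int_mod_self[of y 1] by (auto simp: dvd_eq_mod_eq_0)
  then show "\<pp> dvd x \<or> \<pp> dvd y"
    using uniformizer_power_dvd_iff[of 1 x] uniformizer_power_dvd_iff[of 1 y] by simp
qed

lemmas uniformizer_dvd_mult_iff =
  prime_elem_dvd_mult_iff[OF prime_elem_uniformizer]

lemmas uniformizer_dvd_power_iff =
  prime_elem_dvd_power_iff[OF prime_elem_uniformizer]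

text \<open>
  Factors prime to \<open>p\<close> are dropped by this rule, so that the unit factors in the
  valuation arguments need not be identified.
\<close>

lemma uniformizer_power_dvd_mult_cancel:
  fixes x y :: "'p::prime_card padic_int"
  assumes "\<not> \<pp> dvd x"
  shows "\<pp> ^ k dvd x * y \<longleftrightarrow> \<pp> ^ k dvd y"
proof
  show "\<pp> ^ k dvd x * y \<Longrightarrow> \<pp> ^ k dvd y"
  proof (induction k arbitrary: y)
    case (Suc k)
    have "\<pp> dvd y"
      using Suc.prems assms uniformizer_dvd_mult_iff by (metis dvd_trans dvd_triv_left power_Suc)
    then obtain z where z: "y = \<pp> * z" by (rule dvdE)
    then have "\<pp> ^ k dvd x * z" using Suc.prems by (simp add: mult.left_commute)
    then have "\<pp> ^ k dvd z" by (rule Suc.IH)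
    then show ?case by (simp add: z)
  qed simp
qed simp

lemma uniformizer_dvd_of_nat_iff:
  "\<pp> ^ k dvd (of_nat m :: 'p::prime_card padic_int) \<longleftrightarrow> CARD('p) ^ k dvd m"
proof -
  have "\<pp> ^ k dvd (of_nat m :: 'p padic_int) \<longleftrightarrow> int (m mod CARD('p) ^ k) = 0"
    by (simp add: uniformizer_power_dvd_iff Rep_padic_int_of_nat zmod_int)
  then show ?thesis by (simp add: dvd_eq_mod_eq_0)
qed

lemma uniformizer_dvd_of_nat_iff':
  "\<pp> dvd (of_nat m :: 'p::prime_card padic_int) \<longleftrightarrow> CARD('p) dvd m"
  using uniformizer_dvd_of_nat_iff[of 1 m] by simp

lemma uniformizer_dvd_of_nat_diff_iff:
  "\<pp> ^ k dvd (of_nat x - of_nat y :: 'p::prime_card padic_int) \<longleftrightarrow> [x = y] (mod CARD('p) ^ k)"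
proof -
  have "(of_nat x - of_nat y :: 'p padic_int) = of_int (int x - int y)" by simp
  then have "\<pp> ^ k dvd (of_nat x - of_nat y :: 'p padic_int) \<longleftrightarrow> [int x = int y] (mod int (CARD('p) ^ k))"
    by (simp only: uniformizer_power_dvd_iff Rep_padic_int_of_int)
      (simp add: cong_iff_dvd_diff dvd_eq_mod_eq_0)
  then show ?thesis by (simp only: cong_int_iff)
qed

lemma ex_nat_uniformizer_power_dvd_diff:
  fixes x :: "'p::prime_card padic_int"
  shows "\<exists>m. m < CARD('p) ^ k \<and> \<pp> ^ k dvd of_nat m - x"
proof (intro exI conjI)
  let ?m = "nat (Rep_padic_int x k)"
  have q: "int CARD('p) ^ k > 0" using card_gt_1[where 'p='p] by simp
  have m: "0 \<le> Rep_padic_int x k" "Rep_padic_int x k < int CARD('p) ^ k"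
    using q Rep_padic_int_mod_self[of x k] by (metis pos_mod_sign, metis pos_mod_bound)
  then show "?m < CARD('p) ^ k" by (simp add: nat_less_iff)
  show "\<pp> ^ k dvd of_nat ?m - x"
    unfolding uniformizer_power_dvd_iff minus_padic_int.rep_eq Rep_padic_int_of_nat
    using m by simp
qed

text \<open>
  The diagonal sequence of the entries \<open>X k\<close> modulo \<open>p^k\<close> is coherent.
\<close>

lemma padic_int_complete:
  fixes X :: "nat \<Rightarrow> 'p::prime_card padic_int"
  assumes "\<And>k. \<pp> ^ k dvd X (Suc k) - X k"
  obtains L where "\<And>k. \<pp> ^ k dvd L - X k"
proof
  let ?q = "int CARD('p)"
  define s where "s k = Rep_padic_int (X k) k" for k
  have "s (Suc k) mod ?q ^ k = s k" for k
  proof -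
    have "(Rep_padic_int (X (Suc k)) k - Rep_padic_int (X k) k) mod ?q ^ k = 0"
      using assms[of k] by (simp add: uniformizer_power_dvd_iff minus_padic_int.rep_eq)
    then have "Rep_padic_int (X (Suc k)) k mod ?q ^ k = Rep_padic_int (X k) k mod ?q ^ k"
      by (simp only: mod_eq_dvd_iff dvd_eq_mod_eq_0)
    then show ?thesis by (simp add: s_def)
  qed
  then have rep: "Rep_padic_int (Abs_padic_int s :: 'p padic_int) = s"
    by (intro Abs_padic_int_inverse) simp
  show "\<pp> ^ k dvd Abs_padic_int s - X k" for k
    by (simp add: uniformizer_power_dvd_iff minus_padic_int.rep_eq rep s_def)
qed

text \<open>
  Inverses modulo \<open>p^k\<close> exist because the entries are coprime to \<open>p\<close>; being unique modulo
  \<open>p^k\<close>, they converge to an inverse.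
\<close>

lemma not_uniformizer_dvd_imp_unit:
  fixes w :: "'p::prime_card padic_int"
  assumes w: "\<not> \<pp> dvd w"
  shows "is_unit w"
proof -
  have "\<exists>z. \<pp> ^ k dvd w * z - 1" for k
  proof -
    obtain m where m: "\<pp> ^ Suc k dvd of_nat m - w"
      using ex_nat_uniformizer_power_dvd_diff[of "Suc k" w] by blast
    then have "\<pp> dvd of_nat m - w" using power_le_dvd[of \<pp> "Suc k" _ 1] by simp
    have "\<not> CARD('p) dvd m"
    proof
      assume "CARD('p) dvd m"
      then have "\<pp> dvd (of_nat m :: 'p padic_int)" by (simp add: uniformizer_dvd_of_nat_iff')
      from dvd_diff[OF this \<open>\<pp> dvd of_nat m - w\<close>] show False using w by simp
    qed
    then have cop: "coprime m (CARD('p) ^ k)"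
      using prime_imp_coprime[OF prime_card[where 'a='p], of m] by (simp add: ac_simps)
    then obtain z where "[m * z = 1] (mod CARD('p) ^ k)" using cong_solve_coprime_nat[OF cop] by auto
    then have "\<pp> ^ k dvd (of_nat m * of_nat z - 1 :: 'p padic_int)"
      using uniformizer_dvd_of_nat_diff_iff[of k "m * z" 1, where 'p='p] by simp
    moreover have "\<pp> ^ k dvd (of_nat m - w) * of_nat z"
      using power_le_dvd[OF m, of k] by simp
    ultimately have "\<pp> ^ k dvd (of_nat m * of_nat z - 1) - (of_nat m - w) * of_nat z" by (rule dvd_diff)
    then show ?thesis by (intro exI[of _ "of_nat z"]) (simp add: algebra_simps)
  qed
  then have "\<exists>X. \<forall>k. \<pp> ^ k dvd w * X k - 1" by (intro choice) blast
  then obtain X where X: "\<And>k. \<pp> ^ k dvd w * X k - 1" by blast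
  have step: "\<pp> ^ k dvd X (Suc k) - X k" for k
  proof -
    have "\<pp> ^ k dvd w * X (Suc k) - 1"
      using power_le_dvd[OF X[of "Suc k"], of k] by simp
    then have "\<pp> ^ k dvd (w * X (Suc k) - 1) - (w * X k - 1)" using X[of k] by (rule dvd_diff)
    then have "\<pp> ^ k dvd w * (X (Suc k) - X k)" by (simp add: algebra_simps)
    then show ?thesis using uniformizer_power_dvd_mult_cancel[OF w] by blast
  qed
  obtain L where L: "\<And>k. \<pp> ^ k dvd L - X k"
    using padic_int_complete[where X = X, OF step] by blast
  have "\<pp> ^ k dvd w * L - 1" for k
    using dvd_add[OF dvd_mult[OF L[of k], of w] X[of k]] by (simp add: algebra_simps)
  then have "w * L - 1 = 0" by (rule uniformizer_power_dvd_imp_eq_0)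
  then have "1 = w * L" by simp
  then show ?thesis by (rule dvdI)
qed

lemma uniformizer_decomposition:
  fixes x :: "'p::prime_card padic_int"
  assumes "x \<noteq> 0"
  obtains k z where "x = \<pp> ^ k * z" "\<not> \<pp> dvd z"
proof -
  have fin: "finite {k. \<pp> ^ k dvd x}"
    using finite_padic_powers_dvd[OF assms] by (simp add: uniformizer_def)
  define k where "k = Max {k. \<pp> ^ k dvd x}"
  have "k \<in> {k. \<pp> ^ k dvd x}"
    unfolding k_def using fin by (intro Max_in) (auto intro: exI[of _ 0])
  then obtain z where z: "x = \<pp> ^ k * z" by (auto elim: dvdE)
  have "\<not> \<pp> dvd z"
  proof
    assume "\<pp> dvd z"
    then have "\<pp> ^ Suc k dvd x" by (simp add: z mult.commute mult_dvd_mono)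
    then have "Suc k \<le> k" unfolding k_def using fin by (intro Max_ge) auto
    then show False by simp
  qed
  with z show thesis by (rule that)
qed

lemma of_nat_eq_uniformizer_power_mult:
  assumes "n > 0"
  shows "\<exists>u. (of_nat n :: 'p::prime_card padic_int) = \<pp> ^ multiplicity CARD('p) n * u \<and> \<not> \<pp> dvd u"
proof -
  have "\<not> is_unit CARD('p)" using card_gt_1[where 'p='p] by simp
  then obtain m where m: "n = CARD('p) ^ multiplicity CARD('p) n * m" "\<not> CARD('p) dvd m"
    using assms multiplicity_decompose'[of n "CARD('p)"] by (metis not_gr_zero)
  have "(of_nat n :: 'p padic_int) = of_nat (CARD('p) ^ multiplicity CARD('p) n * m)"
    using m(1) by simp
  then show ?thesis using m(2)
    by (intro exI[of _ "of_nat m"]) (simp add: uniformizer_def uniformizer_dvd_of_nat_iff'[unfolded uniformizer_def])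
qed

text \<open>
  The quotient on the left is the ceiling of \<open>m / d\<close>.
\<close>

lemma ceiling_div_le_iff:
  fixes d m k :: nat
  assumes d: "d > 0"
  shows "(m + (d - 1)) div d \<le> k \<longleftrightarrow> m \<le> k * d"
proof -
  have "(m + (d - 1)) div d \<le> k \<longleftrightarrow> (m + (d - 1)) div d < Suc k" by (rule less_Suc_eq_le[symmetric])
  also have "\<dots> \<longleftrightarrow> m + (d - 1) < Suc k * d" using d by (rule div_less_iff_less_mult)
  also have "\<dots> \<longleftrightarrow> m \<le> k * d" using d by auto
  finally show ?thesis .
qed


text \<open>
  The inequality \<open>e \<le> N + d v\<close> for the valuation \<open>v\<close> of \<open>x\<close>, solved for \<open>v\<close>. The truncated
  difference gives the bound \<open>0\<close> when \<open>e \<le> N\<close>, and \<open>x = 0\<close> satisfies both sides.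
\<close>

lemma uniformizer_power_dvd_monomial_iff:
  fixes x :: "'p::prime_card padic_int"
  assumes d: "d > 0"
  shows "\<pp> ^ e dvd \<pp> ^ N * x ^ d \<longleftrightarrow> \<pp> ^ ((e - N + (d - 1)) div d) dvd x"
proof (cases "x = 0")
  case False
  then obtain k z where x: "x = \<pp> ^ k * z" and z: "\<not> \<pp> dvd z" by (rule uniformizer_decomposition)
  have z': "\<not> \<pp> dvd z ^ d" using z d by (simp add: uniformizer_dvd_power_iff)
  have le: "\<pp> ^ i dvd (\<pp> ^ j :: 'p padic_int) \<longleftrightarrow> i \<le> j" for i j
    using prime_elem_uniformizer[where 'p='p] prime_elem_not_unit[OF prime_elem_uniformizer[where 'p='p]]
    by (simp add: dvd_power_iff)
  have "\<pp> ^ e dvd \<pp> ^ N * x ^ d \<longleftrightarrow> \<pp> ^ e dvd z ^ d * \<pp> ^ (N + k * d)"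
    by (simp add: x power_mult_distrib power_add power_mult[symmetric] mult_ac)
  also have "\<dots> \<longleftrightarrow> e \<le> N + k * d"
    by (simp add: uniformizer_power_dvd_mult_cancel[OF z'] le)
  also have "\<dots> \<longleftrightarrow> (e - N + (d - 1)) div d \<le> k"
    using ceiling_div_le_iff[OF d] by auto
  also have "\<dots> \<longleftrightarrow> \<pp> ^ ((e - N + (d - 1)) div d) dvd z * \<pp> ^ k"
    by (simp add: uniformizer_power_dvd_mult_cancel[OF z] le)
  also have "z * \<pp> ^ k = x" by (simp add: x mult.commute)
  finally show ?thesis .
qed (use d in \<open>auto simp: power_0_left\<close>)

section \<open>Lifting the exponent and roots of unity\<close>

lemma diff_dvd_power_diff: "(x :: 'a::comm_ring_1) - y dvd x ^ n - y ^ n"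
  by (simp add: power_diff_sumr2)

lemma uniformizer_dvd_power_minus_1:
  fixes s :: "'p::prime_card padic_int"
  assumes "\<pp> dvd s - 1"
  shows "\<pp> dvd s ^ m - 1"
  using dvd_trans[OF assms diff_dvd_power_diff[of s 1 m]] by simp

lemma power_eq_linear_mod_square: "(t - 1) ^ 2 dvd t ^ i - 1 - of_nat i * ((t :: 'a::comm_ring_1) - 1)"
proof (induction i)
  case (Suc i)
  have "t ^ Suc i - 1 - of_nat (Suc i) * (t - 1) =
      t * (t ^ i - 1 - of_nat i * (t - 1)) + of_nat i * (t - 1) ^ 2"
    by (simp add: algebra_simps power2_eq_square)
  then show ?case using Suc.IH by simp
qed simp

text \<open>
  This is the step that needs \<open>p\<close> to be odd: modulo \<open>p^2\<close> the sum is
  \<open>p + (t - 1) p (p - 1) / 2\<close>, and both \<open>t - 1\<close> and \<open>p (p - 1) / 2\<close> are divisible by \<open>p\<close>.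
\<close>

lemma geometric_sum_prime_length:
  fixes t :: "'p::prime_card padic_int"
  assumes odd: "CARD('p) \<noteq> 2" and t: "\<pp> dvd t - 1"
  obtains w where "(\<Sum>i<CARD('p). t ^ i) = \<pp> * w" "\<not> \<pp> dvd w"
proof -
  let ?p = "CARD('p)"
  have "\<pp> ^ 2 dvd (t - 1) ^ 2" using t by (rule dvd_power_same)
  then have "\<pp> ^ 2 dvd (\<Sum>i<?p. t ^ i - 1 - of_nat i * (t - 1))"
    by (intro dvd_sum) (blast intro: dvd_trans power_eq_linear_mod_square)
  also have "(\<Sum>i<?p. t ^ i - 1 - of_nat i * (t - 1)) = (\<Sum>i<?p. t ^ i) - \<pp> - of_nat (\<Sum>i<?p. i) * (t - 1)"
    by (simp add: sum_subtractf sum_distrib_right uniformizer_def)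
  finally have 1: "\<pp> ^ 2 dvd (\<Sum>i<?p. t ^ i) - \<pp> - of_nat (\<Sum>i<?p. i) * (t - 1)" .
  have "odd ?p" using odd prime_card[where 'a='p] prime_odd_nat prime_ge_2_nat le_neq_implies_less by metis
  \<comment> \<open>Hence \<open>0 + 1 + ... + (p - 1) = p h\<close> is divisible by \<open>p\<close>.\<close>
  then obtain h where h: "?p = Suc (2 * h)" by (auto elim: oddE)
  have "(\<Sum>i<?p. i) = ?p * h"
  proof -
    have "2 * (\<Sum>i<Suc k. i) = Suc k * k" for k :: nat by (induction k) auto
    from this[of "2 * h"] show ?thesis by (simp add: h)
  qed
  then have "\<pp> * \<pp> dvd of_nat (\<Sum>i<?p. i) * (t - 1)"
    using t by (intro mult_dvd_mono) (simp_all add: uniformizer_def)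
  then have "\<pp> ^ 2 dvd of_nat (\<Sum>i<?p. i) * (t - 1)" by (simp only: power2_eq_square)
  from dvd_add[OF 1 this] have "\<pp> ^ 2 dvd (\<Sum>i<?p. t ^ i) - \<pp>" by simp
  then obtain z where "(\<Sum>i<?p. t ^ i) - \<pp> = \<pp> ^ 2 * z" by (rule dvdE)
  then have "(\<Sum>i<?p. t ^ i) = \<pp> * (1 + \<pp> * z)" by (simp add: algebra_simps power2_eq_square)
  moreover have "\<not> \<pp> dvd 1 + \<pp> * z"
    using prime_elem_not_unit[OF prime_elem_uniformizer[where 'p='p]] by (simp add: dvd_add_left_iff)
  ultimately show thesis by (rule that)
qed

text \<open>
  Factor \<open>s^m - 1\<close> as \<open>s - 1\<close> times a geometric sum if \<open>m\<close> is prime to \<open>p\<close>; the sum is then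
  \<open>m\<close> modulo \<open>p\<close>. Otherwise split off one factor \<open>p\<close> of \<open>m\<close>, for which the geometric sum is
  \<open>p\<close> times a unit. For \<open>m = 0\<close> both sides are \<open>0\<close>, so the statement covers
  exponents such as \<open>(xy)^n - 1\<close> without exception.
\<close>

lemma lifting_the_exponent:
  fixes s :: "'p::prime_card padic_int"
  assumes odd: "CARD('p) \<noteq> 2" and s: "\<pp> dvd s - 1"
  shows "\<exists>w. s ^ m - 1 = of_nat m * (s - 1) * w \<and> \<not> \<pp> dvd w"
proof (induction m rule: less_induct)
  case (less m)
  let ?p = "CARD('p)"
  have one: "\<not> \<pp> dvd (1 :: 'p padic_int)"
    using prime_elem_not_unit[OF prime_elem_uniformizer[where 'p='p]] .
  consider "m = 0" | "\<not> ?p dvd m" | "m > 0" "?p dvd m" by blast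
  then show ?case
  proof cases
    case 1
    then show ?thesis using one by (intro exI[of _ 1]) simp
  next
    case 2
    then have m: "\<not> \<pp> dvd (of_nat m :: 'p padic_int)" by (simp add: uniformizer_dvd_of_nat_iff')
    then obtain v where v: "of_nat m * v = (1 :: 'p padic_int)"
      using not_uniformizer_dvd_imp_unit by (metis dvdE)
    then have v': "\<not> \<pp> dvd v" using one by (metis dvd_mult)
    let ?S = "\<Sum>i<m. s ^ i"
    have "\<pp> dvd (\<Sum>i<m. s ^ i - 1)"
      by (intro dvd_sum uniformizer_dvd_power_minus_1[OF s])
    then have "\<pp> dvd ?S - of_nat m" by (simp add: sum_subtractf)
    then have "\<not> \<pp> dvd ?S" using m by (metis dvd_diff_right_iff diff_diff_eq2 add_diff_cancel_left' dvd_diff)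
    then have "\<not> \<pp> dvd v * ?S" using v' by (simp add: uniformizer_dvd_mult_iff)
    moreover have "s ^ m - 1 = of_nat m * (s - 1) * (v * ?S)"
    proof -
      have "of_nat m * (s - 1) * (v * ?S) = (of_nat m * v) * ((s - 1) * ?S)" by (simp add: mult_ac)
      then show ?thesis by (simp add: v power_diff_1_eq)
    qed
    ultimately show ?thesis by blast
  next
    case 3
    then obtain m' where m': "m = ?p * m'" by (auto elim: dvdE)
    then have "m' < m" using 3 card_gt_1[where 'p='p] by auto
    then obtain w where w: "s ^ m' - 1 = of_nat m' * (s - 1) * w" "\<not> \<pp> dvd w" using less.IH by blast
    have "\<pp> dvd s ^ m' - 1" by (rule uniformizer_dvd_power_minus_1[OF s])
    then obtain u where u: "(\<Sum>i<?p. (s ^ m') ^ i) = \<pp> * u" "\<not> \<pp> dvd u"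
      using geometric_sum_prime_length[OF odd] by blast
    have sm: "s ^ m = (s ^ m') ^ ?p" by (simp add: m' power_mult[symmetric] mult.commute)
    have "s ^ m - 1 = (s ^ m' - 1) * (\<Sum>i<?p. (s ^ m') ^ i)"
      unfolding sm by (rule power_diff_1_eq)
    also have "\<dots> = of_nat m * (s - 1) * (w * u)"
      by (simp add: w(1) u(1) m' uniformizer_def mult_ac)
    finally show ?thesis using w(2) u(2) by (auto simp: uniformizer_dvd_mult_iff)
  qed
qed

text \<open>
  In \<open>0 = m (s - 1) w\<close> the factors \<open>m\<close> and \<open>w\<close> are nonzero.
\<close>

lemma one_units_torsion_free:
  fixes s :: "'p::prime_card padic_int"
  assumes odd: "CARD('p) \<noteq> 2" and s: "\<pp> dvd s - 1" and "m > 0" "s ^ m = 1"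
  shows "s = 1"
proof -
  obtain w where "s ^ m - 1 = of_nat m * (s - 1) * w" "\<not> \<pp> dvd w"
    using lifting_the_exponent[OF odd s] by blast
  then show ?thesis using assms by auto
qed

text \<open>
  The form in which lifting the exponent is used; \<open>z\<close> collects the other factors of a product.
\<close>

lemma power_dvd_power_minus_1_iff:
  fixes s z :: "'p::prime_card padic_int"
  assumes odd: "CARD('p) \<noteq> 2" and s: "\<pp> dvd s - 1"
  shows "\<pp> ^ e dvd (s ^ m - 1) * z \<longleftrightarrow> \<pp> ^ e dvd of_nat m * (s - 1) * z"
proof -
  obtain w where w: "s ^ m - 1 = of_nat m * (s - 1) * w" "\<not> \<pp> dvd w"
    using lifting_the_exponent[OF odd s] by blast
  have "(s ^ m - 1) * z = w * (of_nat m * (s - 1) * z)" by (simp add: w(1) mult_ac)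
  then show ?thesis using uniformizer_power_dvd_mult_cancel[OF w(2)] by metis
qed

lemma fermat_little_padic:
  fixes x :: "'p::prime_card padic_int"
  assumes x: "\<not> \<pp> dvd x"
  shows "\<pp> dvd x ^ (CARD('p) - 1) - 1"
proof -
  let ?p = "CARD('p)"
  obtain m where m: "\<pp> dvd of_nat m - x"
    using ex_nat_uniformizer_power_dvd_diff[of 1 x] by auto
  have "\<not> ?p dvd m"
  proof
    assume "?p dvd m"
    then have "\<pp> dvd (of_nat m :: 'p padic_int)" by (simp add: uniformizer_dvd_of_nat_iff')
    from dvd_diff[OF this m] show False using x by simp
  qed
  then have "[m ^ (?p - 1) = 1] (mod ?p)" by (rule fermat_theorem[OF prime_card])
  then have 1: "\<pp> dvd (of_nat m ^ (?p - 1) - 1 :: 'p padic_int)"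
    using uniformizer_dvd_of_nat_diff_iff[of 1 "m ^ (?p - 1)" 1, where 'p='p] by simp
  have "\<pp> dvd of_nat m ^ (?p - 1) - x ^ (?p - 1)"
    by (rule dvd_trans[OF m diff_dvd_power_diff])
  from dvd_diff[OF 1 this] show ?thesis by simp
qed

lemma root_of_unity_not_uniformizer_dvd:
  fixes a :: "'p::prime_card padic_int"
  assumes "root_of_unity a"
  shows "\<not> \<pp> dvd a"
proof
  assume "\<pp> dvd a"
  moreover obtain m where "m > 0" "a ^ m = 1" using assms by (auto simp: root_of_unity_def)
  ultimately have "\<pp> dvd (1 :: 'p padic_int)" by (metis dvd_power dvd_trans)
  then show False using prime_elem_not_unit[OF prime_elem_uniformizer[where 'p='p]] by simp
qed

text \<open>
  \<open>a^(p - 1)\<close> is a root of unity congruent to \<open>1\<close>, so it is \<open>1\<close>.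
\<close>

lemma root_of_unity_power_eq_1:
  fixes a :: "'p::prime_card padic_int"
  assumes odd: "CARD('p) \<noteq> 2" and a: "root_of_unity a"
  shows "a ^ (CARD('p) - 1) = 1"
proof -
  obtain m where m: "m > 0" "a ^ m = 1" using a by (auto simp: root_of_unity_def)
  have "(a ^ (CARD('p) - 1)) ^ m = 1"
    using m(2) by (metis power_commuting_commutes power_mult mult.commute power_one)
  then show ?thesis
    using one_units_torsion_free[OF odd fermat_little_padic[OF root_of_unity_not_uniformizer_dvd[OF a]] m(1)]
    by blast
qed

text \<open>
  \<open>a / b\<close>, with the inverse of \<open>b\<close> written as \<open>b^(m - 1)\<close>, is a torsion element of
  \<open>1 + p\<int>\<^sub>p\<close>.
\<close>

lemma roots_of_unity_congruent_imp_eq: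
  fixes a b :: "'p::prime_card padic_int"
  assumes odd: "CARD('p) \<noteq> 2" and m: "m > 0" "a ^ m = 1" "b ^ m = 1" and ab: "\<pp> dvd a - b"
  shows "a = b"
proof -
  have b: "b * b ^ (m - 1) = 1" using m by (metis power_eq_if not_gr_zero)
  have "\<pp> dvd (a - b) * b ^ (m - 1)" using ab by simp
  then have "\<pp> dvd a * b ^ (m - 1) - 1" using b by (simp add: algebra_simps)
  moreover have "(a * b ^ (m - 1)) ^ m = 1"
    using m by (simp add: power_mult_distrib) (metis power_mult mult.commute power_one)
  ultimately have "a * b ^ (m - 1) = 1" using one_units_torsion_free[OF odd _ m(1)] by blast
  then show ?thesis using b by (metis mult.assoc mult.commute mult.right_neutral)
qed

section \<open>The pair of congruences as a condition on the first variable\<close>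

text \<open>
  Under the first congruence the second one reads \<open>s^((xy)^n) \<equiv> s\<close>. Lifting the exponent replaces
  \<open>s^((xy)^n - 1) - 1\<close> by \<open>((xy)^n - 1) (s - 1)\<close>, then \<open>(xy)^n - 1 = (st)^n - 1\<close> by \<open>n (st - 1)\<close>, and
  finally \<open>st - 1\<close>, which is \<open>s^(1 + x^n) - 1\<close> modulo \<open>p^e\<close>, by \<open>(1 + x^n) (s - 1)\<close>.
\<close>

lemma tetration_congruences_iff:
  fixes a b s t :: "'p::prime_card padic_int"
  assumes odd: "CARD('p) \<noteq> 2" and s: "\<pp> dvd s - 1" and t: "\<pp> dvd t - 1"
    and x: "x > 0" and y: "y > 0"
    and xs: "of_nat x = a * s" and yt: "of_nat y = b * t" and ab: "a ^ n * b ^ n = 1"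
    and st: "\<pp> ^ e dvd s ^ (x ^ n) - t"
  shows "\<pp> ^ e dvd t ^ (y ^ n) - s \<longleftrightarrow> \<pp> ^ e dvd of_nat n * (s - 1) ^ 2 * (1 + of_nat x ^ n)"
proof -
  define m where "m = (x * y) ^ n - 1"
  have m: "Suc m = x ^ n * y ^ n" using x y by (simp add: m_def power_mult_distrib)
  have s_unit: "\<not> \<pp> dvd s"
    using s prime_elem_not_unit[OF prime_elem_uniformizer[where 'p='p]] dvd_diff[of \<pp> s "s - 1"] by auto
  have st1: "\<pp> dvd s * t - 1"
    using dvd_add[OF dvd_mult[OF t, of s] s] by (simp add: algebra_simps)
  have cong_t: "\<pp> ^ e dvd s ^ Suc m - t ^ (y ^ n)"
    using dvd_trans[OF st diff_dvd_power_diff[of _ _ "y ^ n"]] by (simp only: m power_mult)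
  have "\<pp> ^ e dvd t ^ (y ^ n) - s \<longleftrightarrow> \<pp> ^ e dvd s ^ Suc m - s"
    using dvd_add_right_iff[OF cong_t, of "t ^ (y ^ n) - s"] by simp
  also have "s ^ Suc m - s = s * (s ^ m - 1)" by (simp add: algebra_simps)
  also have "\<pp> ^ e dvd \<dots> \<longleftrightarrow> \<pp> ^ e dvd (s ^ m - 1) * 1"
    by (simp add: uniformizer_power_dvd_mult_cancel[OF s_unit])
  also have "\<dots> \<longleftrightarrow> \<pp> ^ e dvd of_nat m * (s - 1) * 1"
    by (rule power_dvd_power_minus_1_iff[OF odd s])
  also have "of_nat m = (s * t) ^ n - 1"
  proof -
    have "of_nat (Suc m) = (of_nat x ^ n * of_nat y ^ n :: 'p padic_int)" by (simp only: m of_nat_mult of_nat_power)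
    also have "\<dots> = (a ^ n * b ^ n) * (s * t) ^ n" by (simp add: xs yt power_mult_distrib mult_ac)
    finally show ?thesis by (simp add: ab algebra_simps)
  qed
  also have "((s * t) ^ n - 1) * (s - 1) * 1 = ((s * t) ^ n - 1) * (s - 1)" by simp
  also have "\<pp> ^ e dvd \<dots> \<longleftrightarrow> \<pp> ^ e dvd of_nat n * (s * t - 1) * (s - 1)"
    by (rule power_dvd_power_minus_1_iff[OF odd st1])
  also have "\<dots> \<longleftrightarrow> \<pp> ^ e dvd of_nat n * (s ^ Suc (x ^ n) - 1) * (s - 1)"
  proof -
    have eq: "of_nat n * (s ^ Suc (x ^ n) - 1) * (s - 1) =
        s * of_nat n * (s - 1) * (s ^ (x ^ n) - t) + of_nat n * (s * t - 1) * (s - 1)"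
      by (simp add: algebra_simps)
    show ?thesis unfolding eq using st by (simp add: dvd_add_right_iff)
  qed
  also have "of_nat n * (s ^ Suc (x ^ n) - 1) * (s - 1) = (s ^ Suc (x ^ n) - 1) * (of_nat n * (s - 1))"
    by (simp add: mult_ac)
  also have "\<pp> ^ e dvd \<dots> \<longleftrightarrow> \<pp> ^ e dvd of_nat (Suc (x ^ n)) * (s - 1) * (of_nat n * (s - 1))"
    by (rule power_dvd_power_minus_1_iff[OF odd s])
  also have "of_nat (Suc (x ^ n)) * (s - 1) * (of_nat n * (s - 1)) = of_nat n * (s - 1) ^ 2 * (1 + of_nat x ^ n)"
    by (simp add: power2_eq_square mult_ac)
  finally show ?thesis .
qed

text \<open>
  The least \<open>d \<ge> 1\<close> such that \<open>s \<equiv> 1\<close> modulo \<open>p^d\<close> makes \<open>s\<close> a solution modulo \<open>p^e\<close>, where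
  \<open>v = v_p(n)\<close> and the flag marks the case \<open>b^n = -1\<close>. The quotients are the ceilings of
  \<open>(e - 2v) / 3\<close> and \<open>(e - v) / 2\<close>.
\<close>

definition congruence_depth :: "nat \<Rightarrow> bool \<Rightarrow> nat \<Rightarrow> nat" where
  "congruence_depth v degenerate e =
     max 1 (if degenerate then (e - 2 * v + 2) div 3 else (e - v + 1) div 2)"

text \<open>
  If \<open>c = -1\<close>, the last factor is \<open>1 - s^n\<close>, which is \<open>n (s - 1)\<close> up to a unit. Otherwise it is
  congruent to \<open>1 + c\<close>, and this is a unit because \<open>c\<close> and \<open>-1\<close> are distinct \<open>(p - 1)\<close>-th roots
  of unity.
\<close>

lemma fixed_point_depth_iff:
  fixes s c :: "'p::prime_card padic_int"
  assumes odd: "CARD('p) \<noteq> 2" and s: "\<pp> dvd s - 1" and n: "n > 0"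
    and c: "c ^ (CARD('p) - 1) = 1"
  shows "\<pp> ^ e dvd of_nat n * (s - 1) ^ 2 * (1 + c * s ^ n) \<longleftrightarrow>
         \<pp> ^ congruence_depth (multiplicity CARD('p) n) (c = - 1) e dvd s - 1"
proof -
  let ?N = "multiplicity CARD('p) n"
  obtain u :: "'p padic_int" where u: "of_nat n = \<pp> ^ ?N * u" "\<not> \<pp> dvd u"
    using of_nat_eq_uniformizer_power_mult[OF n] by blast
  have s1: "\<pp> ^ max 1 k dvd s - 1 \<longleftrightarrow> \<pp> ^ k dvd s - 1" for k
    using s by (cases k) auto
  show ?thesis
  proof (cases "c = - 1")
    case True
    have "\<pp> ^ e dvd of_nat n * (s - 1) ^ 2 * (1 + c * s ^ n) \<longleftrightarrow>
        \<pp> ^ e dvd - (of_nat n * (s - 1) ^ 2 * (1 + c * s ^ n))" by (simp only: dvd_minus_iff)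
    also have "- (of_nat n * (s - 1) ^ 2 * (1 + c * s ^ n)) = (s ^ n - 1) * (of_nat n * (s - 1) ^ 2)"
      by (simp add: True algebra_simps)
    also have "\<pp> ^ e dvd \<dots> \<longleftrightarrow> \<pp> ^ e dvd of_nat n * (s - 1) * (of_nat n * (s - 1) ^ 2)"
      by (rule power_dvd_power_minus_1_iff[OF odd s])
    also have "of_nat n * (s - 1) * (of_nat n * (s - 1) ^ 2) = u ^ 2 * (\<pp> ^ (2 * ?N) * (s - 1) ^ 3)"
      by (simp add: u(1) power_mult power2_eq_square power3_eq_cube mult_ac power_mult_distrib)
    also have "\<pp> ^ e dvd \<dots> \<longleftrightarrow> \<pp> ^ e dvd \<pp> ^ (2 * ?N) * (s - 1) ^ 3"
      using u(2) by (intro uniformizer_power_dvd_mult_cancel) (simp add: uniformizer_dvd_power_iff)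
    also have "\<dots> \<longleftrightarrow> \<pp> ^ ((e - 2 * ?N + (3 - 1)) div 3) dvd s - 1"
      by (rule uniformizer_power_dvd_monomial_iff) simp
    also have "\<dots> \<longleftrightarrow> \<pp> ^ congruence_depth ?N (c = - 1) e dvd s - 1"
      using s1[of "(e - 2 * ?N + 2) div 3"] by (simp add: congruence_depth_def True)
    finally show ?thesis .
  next
    case False
    have "odd CARD('p)"
      using odd prime_card[where 'a='p] prime_odd_nat prime_ge_2_nat le_neq_implies_less by metis
    then have "even (CARD('p) - 1)" by simp
    then have "\<not> \<pp> dvd c - (- 1)"
      using False roots_of_unity_congruent_imp_eq[OF odd _ c, of "- 1"] card_gt_1[where 'p='p] by auto
    moreover have "\<pp> dvd c * (s ^ n - 1)" using uniformizer_dvd_power_minus_1[OF s] by simp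
    ultimately have "\<not> \<pp> dvd (c - (- 1)) + c * (s ^ n - 1)" by (simp add: dvd_add_left_iff)
    then have "\<not> \<pp> dvd 1 + c * s ^ n" by (simp add: algebra_simps)
    then have nd': "\<not> \<pp> dvd u * (1 + c * s ^ n)" using u(2) by (simp add: uniformizer_dvd_mult_iff)
    have "of_nat n * (s - 1) ^ 2 * (1 + c * s ^ n) = (u * (1 + c * s ^ n)) * (\<pp> ^ ?N * (s - 1) ^ 2)"
      by (simp add: u(1) mult_ac)
    then have "\<pp> ^ e dvd of_nat n * (s - 1) ^ 2 * (1 + c * s ^ n) \<longleftrightarrow> \<pp> ^ e dvd \<pp> ^ ?N * (s - 1) ^ 2"
      by (simp only: uniformizer_power_dvd_mult_cancel[OF nd'])
    also have "\<dots> \<longleftrightarrow> \<pp> ^ ((e - ?N + (2 - 1)) div 2) dvd s - 1"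
      by (rule uniformizer_power_dvd_monomial_iff) simp
    also have "\<dots> \<longleftrightarrow> \<pp> ^ congruence_depth ?N (c = - 1) e dvd s - 1"
      using s1[of "(e - ?N + 1) div 2"] by (simp add: congruence_depth_def False)
    finally show ?thesis .
  qed
qed

text \<open>
  Reducing the congruences modulo \<open>p\<close> gives \<open>a^(x^n) \<equiv> b\<close> and \<open>b^(y^n) \<equiv> a\<close>, and congruent
  \<open>(p - 1)\<close>-th roots of unity are equal. After cancelling them, the congruences are those of
  the one-units \<open>s\<close> and \<open>t\<close>.
\<close>

lemma T_fin_conditions_iff:
  fixes a b :: "'p::prime_card padic_int"
  assumes odd: "CARD('p) \<noteq> 2" and n: "n > 0" and e: "e \<ge> 1"
    and a: "root_of_unity a" and b: "root_of_unity b" and ab: "a ^ n * b ^ n = 1"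
    and x: "x > 0" and y: "y > 0"
  shows "\<pp> dvd of_nat x - a \<and> \<pp> dvd of_nat y - b \<and>
         [x ^ (x ^ n) = y] (mod CARD('p) ^ e) \<and> [y ^ (y ^ n) = x] (mod CARD('p) ^ e) \<longleftrightarrow>
         a ^ (x ^ n) = b \<and> b ^ (y ^ n) = a \<and> [x ^ (x ^ n) = y] (mod CARD('p) ^ e) \<and>
         \<pp> ^ congruence_depth (multiplicity CARD('p) n) (b ^ n = - 1) e dvd of_nat x - a"
    (is "?L \<longleftrightarrow> ?R")
proof -
  let ?p = "CARD('p)" and ?d = "congruence_depth (multiplicity CARD('p) n) (b ^ n = - 1) e"
  have p1: "?p - 1 > 0" using card_gt_1[where 'p='p] by simp
  have a1: "a ^ (?p - 1) = 1" and b1: "b ^ (?p - 1) = 1"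
    by (rule root_of_unity_power_eq_1[OF odd a], rule root_of_unity_power_eq_1[OF odd b])
  have d: "?d \<ge> 1" by (simp add: congruence_depth_def)
  have cong: "[u = v] (mod ?p ^ e) \<longleftrightarrow> \<pp> ^ e dvd (of_nat u - of_nat v :: 'p padic_int)" for u v
    by (simp only: uniformizer_dvd_of_nat_diff_iff)
  have cong_1: "\<pp> dvd (of_nat u - of_nat v :: 'p padic_int)" if "[u = v] (mod ?p ^ e)" for u v
    using power_le_dvd[OF that[unfolded cong] e] by simp
  have power_eq: "f ^ k = g"
    if "f ^ (?p - 1) = 1" "g ^ (?p - 1) = 1" "\<pp> dvd f ^ k - g" for f g :: "'p padic_int" and k
    using roots_of_unity_congruent_imp_eq[OF odd p1 _ that(2,3)] that(1)
    by (metis power_mult mult.commute power_one)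
  have key: "[y ^ (y ^ n) = x] (mod ?p ^ e) \<longleftrightarrow> \<pp> ^ ?d dvd of_nat x - a"
    if xa: "\<pp> dvd of_nat x - a" and yb: "\<pp> dvd of_nat y - b"
      and axb: "a ^ (x ^ n) = b" and bya: "b ^ (y ^ n) = a" and xy: "[x ^ (x ^ n) = y] (mod ?p ^ e)"
  proof -
    have a_unit: "\<not> \<pp> dvd a" and b_unit: "\<not> \<pp> dvd b"
      using a b by (simp_all add: root_of_unity_not_uniformizer_dvd)
    \<comment> \<open>\<open>a^(p - 2)\<close> and \<open>b^(p - 2)\<close> are the inverses of \<open>a\<close> and \<open>b\<close>.\<close>
    define s where "s = of_nat x * a ^ (?p - 2)"
    define t where "t = of_nat y * b ^ (?p - 2)"
    have inv: "c * c ^ (?p - 2) = 1" if "c ^ (?p - 1) = 1" for c :: "'p padic_int"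
      using that p1 by (metis power_Suc Suc_diff_Suc numeral_2_eq_2 diff_Suc_1 zero_less_diff One_nat_def)
    have xs: "of_nat x = a * s" and yt: "of_nat y = b * t"
      using inv[OF a1] inv[OF b1] by (simp_all add: s_def t_def mult.left_commute)
    have xs': "of_nat x - a = a * (s - 1)" and yt': "of_nat y - b = b * (t - 1)"
      by (simp_all add: xs yt algebra_simps)
    have s1: "\<pp> dvd s - 1" using xa a_unit unfolding xs' by (simp add: uniformizer_dvd_mult_iff)
    have t1: "\<pp> dvd t - 1" using yb b_unit unfolding yt' by (simp add: uniformizer_dvd_mult_iff)
    have "of_nat (x ^ (x ^ n)) - of_nat y = b * (s ^ (x ^ n) - t)"
      by (simp add: xs yt power_mult_distrib axb algebra_simps)
    then have st: "\<pp> ^ e dvd s ^ (x ^ n) - t"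
      using xy by (simp only: cong uniformizer_power_dvd_mult_cancel[OF b_unit])
    have "of_nat (y ^ (y ^ n)) - of_nat x = a * (t ^ (y ^ n) - s)"
      by (simp add: xs yt power_mult_distrib bya algebra_simps)
    then have "[y ^ (y ^ n) = x] (mod ?p ^ e) \<longleftrightarrow> \<pp> ^ e dvd t ^ (y ^ n) - s"
      by (simp only: cong uniformizer_power_dvd_mult_cancel[OF a_unit])
    also have "\<dots> \<longleftrightarrow> \<pp> ^ e dvd of_nat n * (s - 1) ^ 2 * (1 + of_nat x ^ n)"
      by (rule tetration_congruences_iff[OF odd s1 t1 x y xs yt ab st])
    also have "of_nat x ^ n = a ^ n * s ^ n" by (simp add: xs power_mult_distrib)
    also have "\<pp> ^ e dvd of_nat n * (s - 1) ^ 2 * (1 + a ^ n * s ^ n) \<longleftrightarrow>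
        \<pp> ^ congruence_depth (multiplicity ?p n) (a ^ n = - 1) e dvd s - 1"
      by (rule fixed_point_depth_iff[OF odd s1 n]) (metis a1 power_mult mult.commute power_one)
    also have "a ^ n = - 1 \<longleftrightarrow> b ^ n = - 1"
      using ab by (metis mult_minus1 mult_minus1_right add.inverse_inverse minus_equation_iff)
    also have "\<pp> ^ ?d dvd s - 1 \<longleftrightarrow> \<pp> ^ ?d dvd of_nat x - a"
      unfolding xs' by (simp add: uniformizer_power_dvd_mult_cancel[OF a_unit])
    finally show ?thesis .
  qed
  show ?thesis
  proof
    assume L: ?L
    have "\<pp> dvd a ^ (x ^ n) - b"
    proof -
      have 1: "\<pp> dvd (of_nat x ^ (x ^ n) - of_nat y :: 'p padic_int)" using cong_1[of "x ^ x ^ n" y] L by simp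
      have 2: "\<pp> dvd of_nat x ^ (x ^ n) - a ^ (x ^ n)"
        using L diff_dvd_power_diff dvd_trans by blast
      have 3: "\<pp> dvd of_nat y - b" using L by blast
      show ?thesis using dvd_add[OF dvd_diff[OF 1 2] 3] by simp
    qed
    moreover have "\<pp> dvd b ^ (y ^ n) - a"
    proof -
      have 1: "\<pp> dvd (of_nat y ^ (y ^ n) - of_nat x :: 'p padic_int)" using cong_1[of "y ^ y ^ n" x] L by simp
      have 2: "\<pp> dvd of_nat y ^ (y ^ n) - b ^ (y ^ n)"
        using L diff_dvd_power_diff dvd_trans by blast
      have 3: "\<pp> dvd of_nat x - a" using L by blast
      show ?thesis using dvd_add[OF dvd_diff[OF 1 2] 3] by simp
    qed
    ultimately have "a ^ (x ^ n) = b" "b ^ (y ^ n) = a" using power_eq a1 b1 by blast+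
    then show ?R using L key by blast
  next
    assume R: ?R
    then have "\<pp> ^ ?d dvd of_nat x - a" by blast
    from power_le_dvd[OF this d] have xa: "\<pp> dvd of_nat x - a" by simp
    have 1: "\<pp> dvd (of_nat x ^ (x ^ n) - of_nat y :: 'p padic_int)" using cong_1[of "x ^ x ^ n" y] R by simp
    have 2: "\<pp> dvd of_nat x ^ (x ^ n) - b"
      using R dvd_trans[OF xa diff_dvd_power_diff[of _ _ "x ^ n"]] by simp
    have "\<pp> dvd of_nat y - b" using dvd_diff[OF 2 1] by simp
    then show ?L using R xa key by blast
  qed
qed

section \<open>Counting the solutions modulo prime powers\<close>

lemma crt_atLeastAtMost:
  fixes m n :: nat
  assumes "coprime m n" "m > 0" "n > 0"
  obtains x where "x \<in> {1..m * n}" "[x = i] (mod m)" "[x = j] (mod n)"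
proof -
  obtain z where z: "[z = i] (mod m)" "[z = j] (mod n)"
    using binary_chinese_remainder_nat[OF assms(1)] by blast
  define x where "x = (if z mod (m * n) = 0 then m * n else z mod (m * n))"
  have "[x = z] (mod m * n)" by (simp add: x_def cong_def)
  then have "[x = z] (mod m)" "[x = z] (mod n)"
    using cong_dvd_modulus_nat by (metis dvd_triv_left, metis dvd_triv_right)
  moreover have "z mod (m * n) < m * n" using assms by simp
  then have "x \<in> {1..m * n}" by (auto simp: x_def)
  ultimately show thesis using z cong_trans that by blast
qed

lemma cong_atLeastAtMost_imp_eq:
  fixes x y m :: nat
  assumes "x \<in> {1..m}" "y \<in> {1..m}" "[x = y] (mod m)"
  shows "x = y"
proof -
  have "[x - 1 = y - 1] (mod m)"
    using assms cong_add_rcancel_nat[of "x - 1" 1 "y - 1" m] by simp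
  then have "x - 1 = y - 1" using assms by (intro cong_less_modulus_unique_nat) auto
  then show ?thesis using assms by auto
qed

lemma cong_exponent_imp_power_eq:
  fixes a :: "'a::monoid_mult"
  assumes "a ^ m = 1" "[i = j] (mod m)"
  shows "a ^ i = a ^ j"
proof -
  have "a ^ i = a ^ (i mod m)" for i
  proof -
    have "a ^ i = a ^ (m * (i div m) + i mod m)" by simp
    also have "\<dots> = a ^ (i mod m)" by (simp only: power_add power_mult assms(1) power_one mult_1_left)
    finally show ?thesis .
  qed
  then show ?thesis using assms(2) unfolding cong_def by metis
qed

lemma card_residues_near:
  fixes a :: "'p::prime_card padic_int"
  assumes "d \<le> e"
  shows "card {x. x < CARD('p) ^ e \<and> \<pp> ^ d dvd of_nat x - a} = CARD('p) ^ (e - d)"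
proof -
  let ?p = "CARD('p)" and ?X = "{x. x < CARD('p) ^ e \<and> \<pp> ^ d dvd of_nat x - a}"
  obtain r where r: "r < ?p ^ d" "\<pp> ^ d dvd of_nat r - a"
    using ex_nat_uniformizer_power_dvd_diff by blast
  have e: "?p ^ e = ?p ^ d * ?p ^ (e - d)" using assms by (simp add: power_add[symmetric])
  have p: "?p ^ d > 0" using card_gt_1[where 'p='p] by simp
  have X: "?X = {x. x < ?p ^ e \<and> x mod ?p ^ d = r}"
  proof -
    have "\<pp> ^ d dvd of_nat x - a \<longleftrightarrow> x mod ?p ^ d = r" for x
    proof -
      have "\<pp> ^ d dvd of_nat x - a \<longleftrightarrow> \<pp> ^ d dvd of_nat x - (of_nat r :: 'p padic_int)"
        using dvd_add_left_iff[OF r(2), of "of_nat x - of_nat r"] by simp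
      then show ?thesis using r(1) by (simp add: uniformizer_dvd_of_nat_diff_iff cong_def)
    qed
    then show ?thesis by simp
  qed
  have "bij_betw (\<lambda>i. r + ?p ^ d * i) {..<?p ^ (e - d)} ?X"
    unfolding X
  proof (rule bij_betw_byWitness[where f' = "\<lambda>x. x div ?p ^ d"])
    show "\<forall>i\<in>{..<?p ^ (e - d)}. (r + ?p ^ d * i) div ?p ^ d = i" using p r(1) by simp
    show "\<forall>x\<in>{x. x < ?p ^ e \<and> x mod ?p ^ d = r}. r + ?p ^ d * (x div ?p ^ d) = x"
      by auto
    show "(\<lambda>i. r + ?p ^ d * i) ` {..<?p ^ (e - d)} \<subseteq> {x. x < ?p ^ e \<and> x mod ?p ^ d = r}"
    proof clarsimp
      fix i assume i: "i < ?p ^ (e - d)"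
      have "r + ?p ^ d * i < ?p ^ d * Suc i" using r(1) by simp
      also have "\<dots> \<le> ?p ^ e" unfolding e using i by (intro mult_le_mono2) simp
      finally show "r + ?p ^ d * i < ?p ^ e \<and> (r mod ?p ^ d = r)" using r(1) by simp
    qed
    show "(\<lambda>x. x div ?p ^ d) ` {x. x < ?p ^ e \<and> x mod ?p ^ d = r} \<subseteq> {..<?p ^ (e - d)}"
      using p by (auto simp: e div_less_iff_less_mult mult.commute)
  qed
  from bij_betw_same_card[OF this] show "card ?X = ?p ^ (e - d)" by simp
qed

text \<open>
  The root of unity part of a solution. It serves both for \<open>T_fin\<close>, where \<open>i\<close> and \<open>j\<close> are the
  residues of \<open>x\<close> and \<open>y\<close> modulo \<open>p - 1\<close>, and for \<open>T_inf\<close>, where they are the components \<open>x0\<close> and \<open>y0\<close>;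
  the range is the one used for the latter.
\<close>

definition exponent_pairs :: "nat \<Rightarrow> 'p::prime_card padic_int \<Rightarrow> 'p padic_int \<Rightarrow> (nat \<times> nat) set" where
  "exponent_pairs n a b =
     {(i, j) \<in> {1..CARD('p) - 1} \<times> {1..CARD('p) - 1}. a ^ (i ^ n) = b \<and> b ^ (j ^ n) = a}"

lemma finite_exponent_pairs: "finite (exponent_pairs n a (b :: 'p::prime_card padic_int))"
  by (rule finite_subset[of _ "{1..CARD('p) - 1} \<times> {1..CARD('p) - 1}"])
    (auto simp: exponent_pairs_def)

lemma congruence_depth_bounds:
  assumes "e \<ge> 1"
  shows "congruence_depth v c e \<ge> 1" "congruence_depth v c e \<le> e"
  using assms by (auto simp: congruence_depth_def)

text \<open>
  Since \<open>p^e\<close> and \<open>p - 1\<close> are coprime, \<open>x\<close> amounts to its classes modulo \<open>p - 1\<close> and \<open>p^e\<close>. The same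
  holds for \<open>y\<close>, but its class modulo \<open>p^e\<close> is prescribed by \<open>y \<equiv> x^(x^n)\<close>. So a solution is
  an exponent pair together with a residue of \<open>x\<close> modulo \<open>p^e\<close> that is congruent to \<open>a\<close>
  to the required depth.
\<close>

lemma card_T_fin:
  fixes a b :: "'p::prime_card padic_int"
  assumes odd: "CARD('p) \<noteq> 2" and n: "n > 0" and e: "e \<ge> 1"
    and a: "root_of_unity a" and b: "root_of_unity b" and ab: "a ^ n * b ^ n = 1"
  shows "card (T_fin n a b e) = card (exponent_pairs n a b) *
           CARD('p) ^ (e - congruence_depth (multiplicity CARD('p) n) (b ^ n = - 1) e)"
proof -
  let ?p = "CARD('p)" and ?d = "congruence_depth (multiplicity CARD('p) n) (b ^ n = - 1) e"
  let ?q = "?p - 1" and ?E = "exponent_pairs n a b"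
  define X where "X = {x. x < ?p ^ e \<and> \<pp> ^ ?d dvd of_nat x - a}"
  have q: "?q > 0" using card_gt_1[where 'p='p] by simp
  have P: "?p ^ e > 0" using card_gt_1[where 'p='p] by simp
  have cop: "coprime (?p ^ e) ?q"
    using q coprime_diff_one_right_nat[of ?p] by simp
  have aq: "a ^ ?q = 1" and bq: "b ^ ?q = 1"
    by (rule root_of_unity_power_eq_1[OF odd a], rule root_of_unity_power_eq_1[OF odd b])
  have unit: "\<not> ?p dvd x" if "\<pp> dvd of_nat x - c" "root_of_unity c" for x and c :: "'p padic_int"
  proof
    assume "?p dvd x"
    then have "\<pp> dvd (of_nat x :: 'p padic_int)" by (simp add: uniformizer_dvd_of_nat_iff')
    from dvd_diff[OF this that(1)] show False using root_of_unity_not_uniformizer_dvd[OF that(2)] by simp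
  qed
  have T: "(x, y) \<in> T_fin n a b e \<longleftrightarrow> x \<in> {1..?p ^ e * ?q} \<and> y \<in> {1..?p ^ e * ?q} \<and>
      a ^ (x ^ n) = b \<and> b ^ (y ^ n) = a \<and> [x ^ (x ^ n) = y] (mod ?p ^ e) \<and> \<pp> ^ ?d dvd of_nat x - a" for x y
  proof -
    have "(x, y) \<in> T_fin n a b e \<longleftrightarrow> x \<in> {1..?p ^ e * ?q} \<and> y \<in> {1..?p ^ e * ?q} \<and>
       (\<pp> dvd of_nat x - a \<and> \<pp> dvd of_nat y - b \<and>
         [x ^ (x ^ n) = y] (mod ?p ^ e) \<and> [y ^ (y ^ n) = x] (mod ?p ^ e))"
      using unit[OF _ a, of x] unit[OF _ b, of y]
      unfolding T_fin_def uniformizer_def by blast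
    then show ?thesis
      using T_fin_conditions_iff[OF odd n e a b ab, of x y] by auto
  qed
  have pow_cong: "c ^ (x ^ n) = c ^ (i ^ n)" if "c ^ ?q = 1" "[x = i] (mod ?q)" for c :: "'p padic_int" and x i
    using cong_exponent_imp_power_eq[OF that(1) cong_pow[OF that(2)]] .
  \<comment> \<open>The representative of \<open>x\<close> modulo \<open>p - 1\<close> in the range \<open>{1..p - 1}\<close> of \<open>exponent_pairs\<close>.\<close>
  define r where "r x = (if x mod ?q = 0 then ?q else x mod ?q)" for x
  have r: "r x \<in> {1..?q}" "[r x = x] (mod ?q)" for x
    using q mod_less_divisor[of ?q x] by (auto simp: r_def cong_def)
  \<comment> \<open>The class of \<open>y\<close> modulo \<open>p^e\<close> is left out because the class of \<open>x\<close> determines it.\<close>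
  define f where "f = (\<lambda>(x, y). ((r x, r y), x mod ?p ^ e))"
  have near_mod: "\<pp> ^ ?d dvd of_nat x - a \<longleftrightarrow> \<pp> ^ ?d dvd of_nat x' - a" if "[x = x'] (mod ?p ^ e)" for x x'
  proof -
    have "\<pp> ^ e dvd (of_nat x - of_nat x' :: 'p padic_int)"
      using that by (simp only: uniformizer_dvd_of_nat_diff_iff)
    then have "\<pp> ^ ?d dvd (of_nat x - of_nat x' :: 'p padic_int)"
      using power_le_dvd congruence_depth_bounds(2)[OF e] by blast
    from dvd_add_right_iff[OF this, of "of_nat x' - a"] show ?thesis by simp
  qed
  have "bij_betw f (T_fin n a b e) (?E \<times> X)"
    unfolding bij_betw_def
  proof
    show "inj_on f (T_fin n a b e)"
    proof (rule inj_onI)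
      fix u v assume u: "u \<in> T_fin n a b e" and v: "v \<in> T_fin n a b e" and eq: "f u = f v"
      obtain x y x' y' where uv: "u = (x, y)" "v = (x', y')" by (cases u, cases v) blast
      have xq: "[x = x'] (mod ?q)" and yq: "[y = y'] (mod ?q)"
        using eq r(2) by (simp_all add: f_def uv) (metis cong_sym cong_trans)+
      have xp: "[x = x'] (mod ?p ^ e)" using eq by (simp add: f_def uv cong_def)
      have xx: "x = x'"
        using u v cong_atLeastAtMost_imp_eq[of x "?p ^ e * ?q" x'] coprime_cong_mult_nat[OF xp xq cop]
        by (simp add: uv T)
      have yp: "[y = y'] (mod ?p ^ e)"
        using u v unfolding uv T xx by (metis cong_sym cong_trans)
      have "y = y'"
        using u v cong_atLeastAtMost_imp_eq[of y "?p ^ e * ?q" y'] coprime_cong_mult_nat[OF yp yq cop]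
        by (simp add: uv T)
      with xx show "u = v" by (simp add: uv)
    qed
    show "f ` T_fin n a b e = ?E \<times> X"
    proof (intro equalityI subsetI)
      fix w assume "w \<in> f ` T_fin n a b e"
      then obtain x y where xy: "(x, y) \<in> T_fin n a b e" and w: "w = ((r x, r y), x mod ?p ^ e)"
        by (auto simp: f_def)
      have "a ^ (r x ^ n) = b" "b ^ (r y ^ n) = a"
        using xy pow_cong[OF aq r(2)] pow_cong[OF bq r(2)] by (simp_all add: T)
      moreover have "x mod ?p ^ e \<in> X"
        using xy P near_mod[of "x mod ?p ^ e" x] by (simp add: X_def T)
      ultimately show "w \<in> ?E \<times> X" using r(1) by (simp add: w exponent_pairs_def)
    next
      fix w assume "w \<in> ?E \<times> X"
      then obtain i j z where w: "w = ((i, j), z)" and ij: "(i, j) \<in> ?E" and z: "z \<in> X" by auto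
      obtain x where x: "x \<in> {1..?p ^ e * ?q}" "[x = z] (mod ?p ^ e)" "[x = i] (mod ?q)"
        using crt_atLeastAtMost[OF cop P q] by blast
      obtain y where y: "y \<in> {1..?p ^ e * ?q}" "[y = x ^ (x ^ n)] (mod ?p ^ e)" "[y = j] (mod ?q)"
        using crt_atLeastAtMost[OF cop P q] by blast
      have "a ^ (x ^ n) = b" "b ^ (y ^ n) = a"
        using ij pow_cong[OF aq x(3)] pow_cong[OF bq y(3)] by (simp_all add: exponent_pairs_def)
      moreover have "\<pp> ^ ?d dvd of_nat x - a"
        using z near_mod[OF x(2)] by (simp add: X_def)
      ultimately have "(x, y) \<in> T_fin n a b e"
        using x y by (simp add: T cong_sym)
      moreover have "f (x, y) = w"
      proof -
        have "r x = i" "r y = j"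
          using ij cong_atLeastAtMost_imp_eq[OF r(1)] cong_trans[OF r(2) x(3)] cong_trans[OF r(2) y(3)]
          by (auto simp: exponent_pairs_def)
        moreover have "x mod ?p ^ e = z" using x(2) z by (simp add: cong_def X_def)
        ultimately show ?thesis by (simp add: f_def w)
      qed
      ultimately show "w \<in> f ` T_fin n a b e" by (metis imageI)
    qed
  qed
  then have "card (T_fin n a b e) = card (?E \<times> X)" by (rule bij_betw_same_card)
  also have "card X = ?p ^ (e - ?d)"
    unfolding X_def by (rule card_residues_near[OF congruence_depth_bounds(2)[OF e]])
  then have "card (?E \<times> X) = card ?E * ?p ^ (e - ?d)"
    by (simp only: card_cartesian_product)
  finally show ?thesis .
qed

lemma diff_ceiling_div_2: "j - (j + 1) div 2 = j div 2" for j :: nat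
proof -
  define q where "q = j div 2"
  have "j = 2 * q \<or> j = 2 * q + 1"
    using div_mult_mod_eq[of j 2] mod_less_divisor[of 2 j] by (simp add: q_def) linarith
  then show ?thesis by (elim disjE) simp_all
qed

lemma diff_ceiling_div_3: "j - (j + 2) div 3 = j div 3 + (j + 1) div 3" for j :: nat
proof -
  define q where "q = j div 3"
  have "j = 3 * q \<or> j = 3 * q + 1 \<or> j = 3 * q + 2"
    using div_mult_mod_eq[of j 3] mod_less_divisor[of 3 j] by (simp add: q_def) linarith
  moreover have "Suc (3 * q) div 3 = q" "Suc (Suc (3 * q)) div 3 = q"
    by (rule div_nat_eqI; simp)+
  ultimately show ?thesis by (elim disjE) simp_all
qed

text \<open>
  If the flag is set and \<open>e > 2v\<close>, the exponent is \<open>\<lfloor>2 (e + v) / 3\<rfloor>\<close>, which equals the sum of the two floors.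
\<close>

lemma minus_congruence_depth:
  assumes "e \<ge> 1"
  shows "e - congruence_depth v c e =
    (if \<not> c then if e \<le> v then e - 1 else (e + v) div 2
     else if e \<le> 2 * v then e - 1 else (e + v) div 3 + (e + v + 1) div 3)"
proof -
  have "e - max 1 ((e - 2 * v + 2) div 3) = (e + v) div 3 + (e + v + 1) div 3" if "\<not> e \<le> 2 * v"
  proof -
    define k where "k = e - 2 * v - 1"
    have k: "e = 2 * v + Suc k" using that by (simp add: k_def)
    have d: "(3 * v + j) div 3 = v + j div 3" for j by simp
    have "e + v = 3 * v + Suc k" "e + v + 1 = 3 * v + (Suc k + 1)" by (simp_all add: k)
    then have rhs: "(e + v) div 3 + (e + v + 1) div 3 = 2 * v + (Suc k div 3 + (Suc k + 1) div 3)"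
      by (simp only: d)
    have le: "(Suc k + 2) div 3 \<le> Suc k" using ceiling_div_le_iff[of 3 "Suc k" "Suc k"] by simp
    have "max 1 ((e - 2 * v + 2) div 3) = (Suc k + 2) div 3" by (simp add: k)
    then have "e - max 1 ((e - 2 * v + 2) div 3) = 2 * v + Suc k - (Suc k + 2) div 3" by (simp only: k)
    also have "\<dots> = 2 * v + (Suc k - (Suc k + 2) div 3)" by (rule diff_add_assoc[OF le])
    also have "\<dots> = (e + v) div 3 + (e + v + 1) div 3" by (simp only: rhs diff_ceiling_div_3)
    finally show ?thesis .
  qed
  moreover have "e - max 1 ((e - v + 1) div 2) = (e + v) div 2" if "\<not> e \<le> v"
  proof -
    define k where "k = e - v - 1"
    have k: "e = v + Suc k" using that by (simp add: k_def)
    have rhs: "(e + v) div 2 = v + Suc k div 2" by (simp add: k)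
    have le: "(Suc k + 1) div 2 \<le> Suc k" using ceiling_div_le_iff[of 2 "Suc k" "Suc k"] by simp
    have "max 1 ((e - v + 1) div 2) = (Suc k + 1) div 2" by (simp add: k)
    then have "e - max 1 ((e - v + 1) div 2) = v + Suc k - (Suc k + 1) div 2" by (simp only: k)
    also have "\<dots> = v + (Suc k - (Suc k + 1) div 2)" by (rule diff_add_assoc[OF le])
    also have "\<dots> = (e + v) div 2" by (simp only: rhs diff_ceiling_div_2)
    finally show ?thesis .
  qed
  ultimately show ?thesis by (auto simp: congruence_depth_def)
qed

section \<open>The p-adic exponential and logarithm\<close>

text \<open>
  The halved exponent is a bound that the terms of both the exponential and the logarithm series
  satisfy. The lemma turns statements on these series into statements on
  partial sums modulo \<open>p^e\<close>.
\<close>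

lemma padic_suminf_approx:
  fixes f :: "nat \<Rightarrow> 'p::prime_card padic_int"
  assumes f: "\<And>k. \<pp> ^ (k div 2) dvd f k" and K: "2 * e \<le> K"
  shows "\<pp> ^ e dvd suminf f - (\<Sum>k<K. f k)"
proof -
  have tail: "\<pp> ^ k dvd (\<Sum>i<m. f i) - (\<Sum>i<2 * k. f i)" if "2 * k \<le> m" for k m
  proof -
    have "(\<Sum>i<m. f i) - (\<Sum>i<2 * k. f i) = (\<Sum>i\<in>{2 * k..<m}. f i)"
      using that sum_diff_nat_ivl[of 0 "2 * k" m f] by (simp add: atLeast0LessThan)
    also have "\<pp> ^ k dvd \<dots>" by (intro dvd_sum power_le_dvd[OF f]) auto
    finally show ?thesis .
  qed
  have step: "\<pp> ^ k dvd (\<Sum>i<2 * Suc k. f i) - (\<Sum>i<2 * k. f i)" for k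
    by (rule tail) simp
  obtain L where L: "\<And>k. \<pp> ^ k dvd L - (\<Sum>i<2 * k. f i)"
    using padic_int_complete[where X = "\<lambda>k. \<Sum>i<2 * k. f i", OF step] by blast
  have approx: "\<pp> ^ k dvd L - (\<Sum>i<m. f i)" if "2 * k \<le> m" for k m
    using dvd_diff[OF L[of k] tail[OF that]] by simp
  have "f sums L"
    unfolding sums_def lim_sequentially
  proof (intro allI impI)
    fix r :: real
    assume r: "r > 0"
    have p: "1 < real CARD('p)" using card_gt_1[where 'p='p] by simp
    obtain k where k: "(1 / real CARD('p)) ^ k < r"
      using real_arch_pow_inv[OF r, of "1 / real CARD('p)"] p by auto
    have "dist (\<Sum>i<m. f i) L < r" if "m \<ge> 2 * k" for m
    proof -
      have "\<pp> ^ k dvd - (L - (\<Sum>i<m. f i))"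
        using approx[OF that] by (simp only: dvd_minus_iff)
      then have "of_nat CARD('p) ^ k dvd (\<Sum>i<m. f i) - L"
        by (simp add: uniformizer_def)
      then have "dist (\<Sum>i<m. f i) L \<le> 1 / real CARD('p) ^ k"
        by (simp only: dist_padic_int_def padic_abs_le_iff_dvd)
      then show ?thesis using k by (simp add: power_one_over)
    qed
    then show "\<exists>no. \<forall>m\<ge>no. dist (\<Sum>i<m. f i) L < r" by blast
  qed
  then have "suminf f = L" by (rule sums_unique[symmetric])
  then show ?thesis using approx[OF K] by simp
qed

text \<open>
  One step of Legendre's formula: the multiples of \<open>p\<close> among \<open>1, ..., k\<close> are \<open>p\<close> times
  \<open>1, ..., k div p\<close>.
\<close>

lemma multiplicity_fact_eq:
  fixes p :: nat
  assumes p: "prime p"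
  shows "multiplicity p (fact k :: nat) = k div p + multiplicity p (fact (k div p) :: nat)"
proof (induction k)
  case (Suc k)
  have pe: "prime_elem p" using p by simp
  have p2: "p \<ge> 2" using p by (rule prime_ge_2_nat)
  have 1: "multiplicity p (fact (Suc m) :: nat) = multiplicity p (Suc m) + multiplicity p (fact m :: nat)" for m
    unfolding fact_Suc using pe by (subst prime_elem_multiplicity_mult_distrib) auto
  show ?case
  proof (cases "p dvd Suc k")
    case True
    then obtain q where q: "Suc k = p * q" by (rule dvdE)
    then obtain r where r: "q = Suc r" by (cases q) auto
    have "k div p = r" using q r p2 by (intro div_nat_eqI) auto
    moreover have "Suc k div p = Suc r" using q r p2 by simp
    moreover have "multiplicity p (Suc k) = Suc (multiplicity p (Suc r))"
      unfolding q r using p p2 by (intro multiplicity_times_same) auto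
    ultimately show ?thesis using 1[of k] 1[of r] Suc.IH by simp
  next
    case False
    then have "Suc k div p = k div p" by (simp add: div_Suc dvd_eq_mod_eq_0)
    then show ?thesis using 1[of k] Suc.IH not_dvd_imp_multiplicity_0[OF False] by simp
  qed
qed simp

text \<open>
  From \<open>v_p(k!) = k div p + v_p((k div p)!)\<close> and induction, \<open>2 v_p(k!) \<le> 3 (k div p)\<close>, and \<open>3 \<le> p\<close>.
\<close>

lemma double_multiplicity_fact_le:
  fixes p :: nat
  assumes p: "prime p" "p \<noteq> 2"
  shows "2 * multiplicity p (fact k :: nat) \<le> k"
proof (induction k rule: less_induct)
  case (less k)
  have p3: "p \<ge> 3" using p prime_ge_2_nat[OF p(1)] by simp
  show ?case
  proof (cases "k = 0")
    case False
    then have "2 * multiplicity p (fact (k div p) :: nat) \<le> k div p" using p3 by (intro less.IH) simp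
    then have "2 * multiplicity p (fact k :: nat) \<le> 3 * (k div p)"
      using multiplicity_fact_eq[OF p(1), of k] by simp
    also have "\<dots> \<le> p * (k div p)" using p3 by simp
    also have "\<dots> \<le> k" by simp
    finally show ?thesis .
  qed simp
qed

lemma double_multiplicity_le:
  fixes p :: nat
  assumes p: "prime p" "p \<noteq> 2"
  shows "2 * multiplicity p (Suc k) \<le> Suc k"
proof -
  have "multiplicity p (Suc k) \<le> multiplicity p (fact (Suc k) :: nat)"
    by (intro dvd_imp_multiplicity_le) (simp_all add: dvd_fact del: fact_Suc)
  then show ?thesis using double_multiplicity_fact_le[OF p, of "Suc k"] by linarith
qed

text \<open>
  The terms \<open>w^k / k!\<close> and \<open>w^k / k\<close> of the two series are instances. The first statement says that
  the exact division is the true quotient, so identities between terms may be proved after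
  multiplication by \<open>d\<close>.
\<close>

lemma integral_quotient:
  fixes w :: "'p::prime_card padic_int"
  assumes w: "\<pp> dvd w" and d: "d > 0" and v: "2 * multiplicity CARD('p) d \<le> k"
  shows "of_nat d * (w ^ k div of_nat d) = w ^ k" and "\<pp> ^ (k div 2) dvd w ^ k div of_nat d"
proof -
  let ?v = "multiplicity CARD('p) d"
  obtain u :: "'p padic_int" where u: "of_nat d = \<pp> ^ ?v * u" "\<not> \<pp> dvd u"
    using of_nat_eq_uniformizer_power_mult[OF d] by blast
  obtain u' where u': "1 = u * u'" using not_uniformizer_dvd_imp_unit[OF u(2)] by (rule dvdE)
  obtain z where z: "w = \<pp> * z" using w by (rule dvdE)
  have "w ^ k = \<pp> ^ (?v + (k - ?v)) * z ^ k" using v by (simp add: z power_mult_distrib)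
  also have "\<dots> = \<pp> ^ ?v * (u * u') * \<pp> ^ (k - ?v) * z ^ k" by (simp add: power_add u'[symmetric])
  also have "\<dots> = of_nat d * (\<pp> ^ (k - ?v) * (u' * z ^ k))" by (simp add: u(1) mult_ac)
  finally have wk: "w ^ k = of_nat d * (\<pp> ^ (k - ?v) * (u' * z ^ k))" .
  then have q: "w ^ k div of_nat d = \<pp> ^ (k - ?v) * (u' * z ^ k)"
    using d by simp
  show "of_nat d * (w ^ k div of_nat d) = w ^ k" unfolding q by (rule wk[symmetric])
  have "\<pp> ^ (k div 2) dvd (\<pp> ^ (k - ?v) :: 'p padic_int)" using v by (intro le_imp_power_dvd) linarith
  then show "\<pp> ^ (k div 2) dvd w ^ k div of_nat d" unfolding q by simp
qed

context
  assumes odd: "CARD('p::prime_card) \<noteq> 2"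
begin

lemma exp_term:
  fixes w :: "'p padic_int"
  assumes w: "\<pp> dvd w"
  shows "fact k * (w ^ k div fact k) = w ^ k" and "\<pp> ^ (k div 2) dvd w ^ k div fact k"
  using integral_quotient[OF w, of "fact k" k] double_multiplicity_fact_le[OF prime_card odd, of k]
  by simp_all

lemma exp_term_add:
  fixes u w :: "'p padic_int"
  assumes u: "\<pp> dvd u" and w: "\<pp> dvd w"
  shows "(u + w) ^ k div fact k = (\<Sum>i\<le>k. (u ^ i div fact i) * (w ^ (k - i) div fact (k - i)))"
proof -
  have "fact k * (\<Sum>i\<le>k. (u ^ i div fact i) * (w ^ (k - i) div fact (k - i))) =
      (\<Sum>i\<le>k. of_nat (k choose i) * u ^ i * w ^ (k - i))"
    unfolding sum_distrib_left
  proof (rule sum.cong)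
    fix i assume "i \<in> {..k}"
    then have "(fact k :: 'p padic_int) = of_nat (fact i * fact (k - i) * (k choose i))"
      by (simp only: binomial_fact_lemma of_nat_fact atMost_iff)
    then have "fact k * ((u ^ i div fact i) * (w ^ (k - i) div fact (k - i))) =
        of_nat (k choose i) * (fact i * (u ^ i div fact i)) * (fact (k - i) * (w ^ (k - i) div fact (k - i)))"
      by (simp add: mult_ac)
    then show "fact k * ((u ^ i div fact i) * (w ^ (k - i) div fact (k - i))) =
        of_nat (k choose i) * u ^ i * w ^ (k - i)"
      by (simp only: exp_term(1)[OF u] exp_term(1)[OF w])
  qed simp
  also have "\<dots> = (u + w) ^ k" by (rule binomial_ring[symmetric])
  also have "\<dots> = fact k * ((u + w) ^ k div fact k)"
    using exp_term(1)[OF dvd_add[OF u w]] by simp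
  finally show ?thesis by simp
qed

lemma padic_exp_approx:
  fixes w :: "'p padic_int"
  assumes "\<pp> dvd w" "2 * e \<le> K"
  shows "\<pp> ^ e dvd padic_exp w - (\<Sum>k<K. w ^ k div fact k)"
  unfolding padic_exp_def by (rule padic_suminf_approx[OF exp_term(2)[OF assms(1)] assms(2)])

text \<open>
  The Cauchy product of the two series. Modulo \<open>p^e\<close> only the indices \<open>i + j < K\<close> of the
  product of two partial sums matter, and there the product is the binomial formula.
\<close>

lemma padic_exp_add:
  fixes u w :: "'p padic_int"
  assumes u: "\<pp> dvd u" and w: "\<pp> dvd w"
  shows "padic_exp (u + w) = padic_exp u * padic_exp w"
proof -
  have "\<pp> ^ e dvd padic_exp u * padic_exp w - padic_exp (u + w)" for e
  proof -
    \<comment> \<open>The excess of \<open>2\<close> makes up for the rounding: if \<open>i + j \<ge> K\<close>, then \<open>i div 2 + j div 2 \<ge> e\<close>.\<close>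
    define K where "K = 2 * e + 2"
    define f where "f i = u ^ i div fact i" for i
    define g where "g j = w ^ j div fact j" for j
    define h where "h k = (u + w) ^ k div fact k" for k
    have f: "\<pp> ^ (i div 2) dvd f i" and g: "\<pp> ^ (i div 2) dvd g i" for i
      by (simp_all only: f_def g_def exp_term(2)[OF u] exp_term(2)[OF w])
    let ?A = "\<Sum>i<K. f i" and ?B = "\<Sum>j<K. g j" and ?C = "\<Sum>k<K. h k"
    have A: "\<pp> ^ e dvd padic_exp u - ?A" and B: "\<pp> ^ e dvd padic_exp w - ?B"
      and C: "\<pp> ^ e dvd padic_exp (u + w) - ?C"
      unfolding f_def g_def h_def by (intro padic_exp_approx u w dvd_add; simp add: K_def)+
    let ?Q = "{..<K} \<times> {..<K}" and ?T = "{(i, j). i + j < K}"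
    have "?C = (\<Sum>k<K. \<Sum>i\<le>k. f i * g (k - i))"
      by (simp add: h_def f_def g_def exp_term_add[OF u w])
    also have "\<dots> = (\<Sum>(i, j)\<in>?T. f i * g j)" by (rule sum.triangle_reindex[symmetric])
    finally have C': "?C = (\<Sum>(i, j)\<in>?T. f i * g j)" .
    have "?A * ?B = (\<Sum>(i, j)\<in>?Q. f i * g j)" by (simp add: sum_product sum.cartesian_product)
    also have "\<dots> = (\<Sum>(i, j)\<in>?Q - ?T. f i * g j) + (\<Sum>(i, j)\<in>?T. f i * g j)"
      by (rule sum.subset_diff) auto
    finally have AB: "?A * ?B - ?C = (\<Sum>(i, j)\<in>?Q - ?T. f i * g j)" by (simp add: C')
    have "\<pp> ^ e dvd f i * g j" if "i + j \<ge> K" for i j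
    proof -
      have "\<pp> ^ (i div 2 + j div 2) dvd f i * g j" unfolding power_add using f g by (rule mult_dvd_mono)
      moreover have "e \<le> i div 2 + j div 2" using that unfolding K_def by linarith
      ultimately show ?thesis by (rule power_le_dvd)
    qed
    then have "\<pp> ^ e dvd ?A * ?B - ?C" unfolding AB by (intro dvd_sum) auto
    moreover have "\<pp> ^ e dvd padic_exp u * (padic_exp w - ?B) + ?B * (padic_exp u - ?A)"
      using A B by (intro dvd_add dvd_mult)
    ultimately have "\<pp> ^ e dvd (?A * ?B - ?C) + (padic_exp u * (padic_exp w - ?B) + ?B * (padic_exp u - ?A))
        - (padic_exp (u + w) - ?C)"
      using C by (metis dvd_add dvd_diff)
    then show ?thesis by (simp add: algebra_simps)
  qed
  then have "padic_exp u * padic_exp w - padic_exp (u + w) = 0" by (rule uniformizer_power_dvd_imp_eq_0)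
  then show ?thesis by simp
qed

text \<open>
  The \<open>i\<close>-th term of the series at \<open>p^k w\<close> has the factor \<open>(p^k)^i\<close>, so all terms after \<open>1 + p^k w\<close>
  are divisible by \<open>p^(2k)\<close>.
\<close>

lemma padic_exp_linear:
  fixes w :: "'p padic_int"
  assumes w: "\<pp> dvd w"
  shows "\<pp> ^ (2 * k) dvd padic_exp (\<pp> ^ k * w) - 1 - \<pp> ^ k * w"
proof -
  let ?z = "\<pp> ^ k * w"
  have z: "\<pp> dvd ?z" using w by simp
  have "\<pp> ^ (2 * k) dvd ?z ^ Suc (Suc i) div fact (Suc (Suc i))" for i
  proof -
    let ?m = "Suc (Suc i)"
    have "fact ?m * (?z ^ ?m div fact ?m) = (\<pp> ^ k) ^ ?m * (fact ?m * (w ^ ?m div fact ?m))"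
      by (simp only: exp_term(1)[OF z] exp_term(1)[OF w]) (rule power_mult_distrib)
    also have "\<dots> = fact ?m * ((\<pp> ^ k) ^ ?m * (w ^ ?m div fact ?m))" by (simp only: mult_ac)
    finally have "?z ^ ?m div fact ?m = (\<pp> ^ k) ^ ?m * (w ^ ?m div fact ?m)"
      by (simp only: mult_cancel_left fact_nonzero simp_thms)
    also have "\<dots> = \<pp> ^ (2 * k) * ((\<pp> ^ k) ^ i * (w ^ ?m div fact ?m))"
      by (simp only: mult_2 power_add power_Suc mult.assoc)
    finally show ?thesis by simp
  qed
  \<comment> \<open>Any partial sum with at least \<open>4k\<close> terms agrees with the series modulo \<open>p^(2k)\<close>; two more
    terms allow the first two to be split off.\<close>
  then have "\<pp> ^ (2 * k) dvd (\<Sum>i<4 * k. ?z ^ Suc (Suc i) div fact (Suc (Suc i)))"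
    by (intro dvd_sum)
  also have "(\<Sum>i<4 * k. ?z ^ Suc (Suc i) div fact (Suc (Suc i))) =
      (\<Sum>i<4 * k + 2. ?z ^ i div fact i) - 1 - ?z"
    by (simp add: sum.lessThan_Suc_shift del: sum.lessThan_Suc power_Suc fact_Suc)
  finally have 1: "\<pp> ^ (2 * k) dvd (\<Sum>i<4 * k + 2. ?z ^ i div fact i) - 1 - ?z" .
  have "\<pp> ^ (2 * k) dvd padic_exp ?z - (\<Sum>i<4 * k + 2. ?z ^ i div fact i)"
    by (rule padic_exp_approx[OF z]) simp
  from dvd_add[OF this 1] show ?thesis by (simp add: algebra_simps)
qed

lemma padic_exp_0: "padic_exp (0 :: 'p padic_int) = 1"
proof -
  have "\<pp> ^ k dvd padic_exp (0 :: 'p padic_int) - 1" for k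
    using power_le_dvd[OF padic_exp_linear[of 0 k], of k] by simp
  then have "padic_exp (0 :: 'p padic_int) - 1 = 0" by (rule uniformizer_power_dvd_imp_eq_0)
  then show ?thesis by simp
qed

lemma uniformizer_dvd_padic_exp_minus_1:
  fixes w :: "'p padic_int"
  assumes w: "\<pp> dvd w"
  shows "\<pp> dvd padic_exp w - 1"
proof -
  have "\<pp> ^ 1 dvd padic_exp w - (\<Sum>k<2. w ^ k div fact k)"
    by (rule padic_exp_approx[OF w]) simp
  also have "(\<Sum>k<2. w ^ k div fact k) = 1 + w" by (simp add: numeral_2_eq_2)
  finally show ?thesis using dvd_add[OF _ w, of "padic_exp w - (1 + w)"] by simp
qed

lemma padic_exp_of_nat_mult:
  fixes w :: "'p padic_int"
  assumes w: "\<pp> dvd w"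
  shows "padic_exp (of_nat m * w) = padic_exp w ^ m"
proof (induction m)
  case (Suc m)
  have "padic_exp (of_nat (Suc m) * w) = padic_exp (w + of_nat m * w)" by (simp add: algebra_simps)
  also have "\<dots> = padic_exp w * padic_exp (of_nat m * w)" using w by (intro padic_exp_add) auto
  finally show ?case by (simp add: Suc.IH)
qed (simp add: padic_exp_0)

text \<open>
  \<open>(i + 1)\<close> times the binomial coefficient is divisible by \<open>p^k\<close>, and \<open>v_p(i + 1) \<le> i + 1\<close>.
\<close>

lemma uniformizer_power_dvd_binomial:
  assumes "k \<ge> e + Suc i"
  shows "\<pp> ^ e dvd (of_nat (CARD('p) ^ k choose Suc i) :: 'p padic_int)"
proof -
  let ?v = "multiplicity CARD('p) (Suc i)" and ?c = "of_nat (CARD('p) ^ k choose Suc i) :: 'p padic_int"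
  obtain u :: "'p padic_int" where u: "of_nat (Suc i) = \<pp> ^ ?v * u" "\<not> \<pp> dvd u"
    using of_nat_eq_uniformizer_power_mult[of "Suc i"] by blast
  have "of_nat (Suc i * (CARD('p) ^ k choose Suc i)) =
      (of_nat (CARD('p) ^ k * ((CARD('p) ^ k - 1) choose i)) :: 'p padic_int)"
    by (simp only: binomial_absorption)
  then have "\<pp> ^ ?v * (u * ?c) = \<pp> ^ k * of_nat ((CARD('p) ^ k - 1) choose i)"
    by (simp only: of_nat_mult of_nat_power u(1) uniformizer_def[symmetric] mult.assoc)
  then have "\<pp> ^ k dvd \<pp> ^ ?v * (u * ?c)" by simp
  moreover have "?v + e \<le> k" using assms double_multiplicity_le[OF prime_card odd, of i] by linarith
  ultimately have "\<pp> ^ (?v + e) dvd \<pp> ^ ?v * (u * ?c)" by (rule power_le_dvd)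
  then have "\<pp> ^ e dvd u * ?c" by (simp add: power_add)
  then show ?thesis by (simp only: uniformizer_power_dvd_mult_cancel[OF u(2)])
qed

text \<open>
  Pascal's rule: neighbouring entries of row \<open>p^k - 1\<close> add up to an entry of row \<open>p^k\<close>, which is
  nearly \<open>0\<close>, so the entries alternate between values close to \<open>1\<close> and \<open>-1\<close>.
\<close>

lemma binomial_minus_one_cong:
  assumes "k \<ge> e + i"
  shows "\<pp> ^ e dvd (of_nat ((CARD('p) ^ k - 1) choose i) - (- 1) ^ i :: 'p padic_int)"
  using assms
proof (induction i)
  case (Suc i)
  let ?q = "CARD('p) ^ k"
  have q: "?q = Suc (?q - 1)" using card_gt_1[where 'p='p] by simp
  have "?q choose Suc i = ((?q - 1) choose i) + ((?q - 1) choose Suc i)"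
    by (subst q) (rule binomial_Suc_Suc)
  then have eq: "of_nat ((?q - 1) choose Suc i) - (- 1) ^ Suc i =
      (of_nat (?q choose Suc i) - (of_nat ((?q - 1) choose i) - (- 1) ^ i) :: 'p padic_int)"
    by simp
  show ?case unfolding eq
    using Suc.prems by (intro dvd_diff[OF uniformizer_power_dvd_binomial Suc.IH]) auto
qed simp

lemma log_term:
  fixes s :: "'p padic_int"
  assumes s: "\<pp> dvd s - 1"
  shows "of_nat (Suc k) * ((s - 1) ^ Suc k div of_nat (Suc k)) = (s - 1) ^ Suc k"
    and "\<pp> ^ (k div 2) dvd (s - 1) ^ Suc k div of_nat (Suc k)"
    and "(- 1) ^ k * (s - 1) ^ Suc k div of_nat (Suc k) = (- 1) ^ k * ((s - 1) ^ Suc k div of_nat (Suc k))"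
proof -
  note q = integral_quotient[OF s, of "Suc k" "Suc k", OF _ double_multiplicity_le[OF prime_card odd]]
  let ?g = "(s - 1) ^ Suc k div of_nat (Suc k)"
  show 1: "of_nat (Suc k) * ?g = (s - 1) ^ Suc k" using q(1) by blast
  have "\<pp> ^ (Suc k div 2) dvd ?g" using q(2) by blast
  then show "\<pp> ^ (k div 2) dvd ?g" by (rule power_le_dvd) simp
  have "of_nat (Suc k) * ((- 1) ^ k * ?g) = (- 1) ^ k * (of_nat (Suc k) * ?g)"
    by (rule mult.left_commute)
  also have "\<dots> = (- 1) ^ k * (s - 1) ^ Suc k" by (simp only: 1)
  finally have "(- 1) ^ k * (s - 1) ^ Suc k = of_nat (Suc k) * ((- 1) ^ k * ?g)" by (rule sym)
  then show "(- 1) ^ k * (s - 1) ^ Suc k div of_nat (Suc k) = (- 1) ^ k * ?g"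
    by (simp only: nonzero_mult_div_cancel_left[OF of_nat_neq_0])
qed

text \<open>
  The limit formula \<open>log s = lim (s^(p^k) - 1) / p^k\<close>, with the precision \<open>p^e\<close> reached for \<open>k \<ge> 3e\<close>.
  By the binomial theorem \<open>(s^q - 1) / q\<close>, for \<open>q = p^k\<close>, is the sum of the terms
  \<open>C(q - 1, i) (s - 1)^(i + 1) / (i + 1)\<close>, and \<open>C(q - 1, i)\<close> tends to \<open>(-1)^i\<close> as \<open>k\<close> grows. The first \<open>2e\<close> terms
  are compared with the logarithm series by this convergence, the others vanish modulo \<open>p^e\<close>.
\<close>

lemma padic_log_limit:
  fixes s :: "'p padic_int"
  assumes s: "\<pp> dvd s - 1" and k: "k \<ge> 3 * e"
  shows "\<pp> ^ (k + e) dvd s ^ (CARD('p) ^ k) - 1 - \<pp> ^ k * padic_log s"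
proof -
  define g where "g i = (s - 1) ^ Suc i div of_nat (Suc i)" for i
  define q where "q = CARD('p) ^ k"
  define c where "c i = (of_nat ((q - 1) choose i) :: 'p padic_int)" for i
  have g: "\<pp> ^ (i div 2) dvd g i" for i unfolding g_def by (rule log_term(2)[OF s])
  have "k < q" unfolding q_def using card_gt_1[where 'p='p] by (intro power_gt_expt) simp
  then have K: "2 * e \<le> q" using k by simp
  have "s ^ q - 1 = (\<Sum>i<q. of_nat (q choose Suc i) * (s - 1) ^ Suc i)"
  proof -
    have "s ^ q = ((s - 1) + 1) ^ q" by simp
    also have "\<dots> = (\<Sum>i\<le>q. of_nat (q choose i) * (s - 1) ^ i * 1 ^ (q - i))" by (rule binomial_ring)
    also have "\<dots> = 1 + (\<Sum>i<q. of_nat (q choose Suc i) * (s - 1) ^ Suc i)"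
      by (simp add: sum.atMost_shift del: power_Suc)
    finally show ?thesis by simp
  qed
  also have "\<dots> = (\<Sum>i<q. \<pp> ^ k * (c i * g i))"
  proof (rule sum.cong)
    fix i
    have "of_nat (q choose Suc i) * (s - 1) ^ Suc i = of_nat (q choose Suc i) * (of_nat (Suc i) * g i)"
      unfolding g_def by (simp only: log_term(1)[OF s])
    also have "\<dots> = of_nat (Suc i * (q choose Suc i)) * g i" by (simp only: of_nat_mult mult_ac)
    also have "Suc i * (q choose Suc i) = q * ((q - 1) choose i)" by (rule binomial_absorption)
    also have "of_nat \<dots> * g i = \<pp> ^ k * (c i * g i)"
      by (simp add: c_def uniformizer_def q_def mult.assoc)
    finally show "of_nat (q choose Suc i) * (s - 1) ^ Suc i = \<pp> ^ k * (c i * g i)" .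
  qed simp
  finally have sq: "s ^ q - 1 - \<pp> ^ k * padic_log s = \<pp> ^ k * ((\<Sum>i<q. c i * g i) - padic_log s)"
    by (simp add: sum_distrib_left algebra_simps)
  have log: "padic_log s = suminf (\<lambda>i. (- 1) ^ i * g i)"
    unfolding padic_log_def g_def by (simp only: log_term(3)[OF s])
  have 1: "\<pp> ^ e dvd suminf (\<lambda>i. (- 1) ^ i * g i) - (\<Sum>i<2 * e. (- 1) ^ i * g i)"
    using g by (intro padic_suminf_approx dvd_mult) auto
  have 2: "\<pp> ^ e dvd (\<Sum>i<2 * e. (c i - (- 1) ^ i) * g i)"
    unfolding c_def q_def using k by (intro dvd_sum dvd_mult2 binomial_minus_one_cong) auto
  have 3: "\<pp> ^ e dvd (\<Sum>i\<in>{2 * e..<q}. c i * g i)"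
    by (intro dvd_sum dvd_mult power_le_dvd[OF g]) auto
  have "(\<Sum>i<q. c i * g i) = (\<Sum>i<2 * e. c i * g i) + (\<Sum>i\<in>{2 * e..<q}. c i * g i)"
    using K by (simp add: atLeast0LessThan[symmetric] sum.atLeastLessThan_concat)
  then have "(\<Sum>i<q. c i * g i) - padic_log s = (\<Sum>i<2 * e. (c i - (- 1) ^ i) * g i) +
      (\<Sum>i\<in>{2 * e..<q}. c i * g i) - (suminf (\<lambda>i. (- 1) ^ i * g i) - (\<Sum>i<2 * e. (- 1) ^ i * g i))"
    by (simp add: log left_diff_distrib sum_subtractf)
  moreover have "\<pp> ^ e dvd \<dots>" by (rule dvd_diff[OF dvd_add[OF 2 3] 1])
  ultimately have "\<pp> ^ e dvd (\<Sum>i<q. c i * g i) - padic_log s" by simp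
  then show ?thesis unfolding sq[unfolded q_def] power_add by (intro mult_dvd_mono) (simp_all add: q_def)
qed

text \<open>
  By additivity \<open>exp(w)^(p^k) - 1 = exp(p^k w) - 1\<close>, which is \<open>p^k w\<close> up to \<open>p^(2k)\<close>; divide by \<open>p^k\<close> in
  the limit formula.
\<close>

lemma padic_log_exp:
  fixes w :: "'p padic_int"
  assumes w: "\<pp> dvd w"
  shows "padic_log (padic_exp w) = w"
proof -
  have "\<pp> ^ e dvd padic_log (padic_exp w) - w" for e
  proof -
    \<comment> \<open>Large enough for the limit formula to hold modulo \<open>p^e\<close>, and for \<open>k + e \<le> 2k\<close>.\<close>
    define k where "k = 3 * e"
    have "\<pp> ^ (k + e) dvd padic_exp w ^ (CARD('p) ^ k) - 1 - \<pp> ^ k * padic_log (padic_exp w)"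
      by (rule padic_log_limit[OF uniformizer_dvd_padic_exp_minus_1[OF w]]) (simp add: k_def)
    moreover have "padic_exp w ^ (CARD('p) ^ k) = padic_exp (\<pp> ^ k * w)"
      using padic_exp_of_nat_mult[OF w, of "CARD('p) ^ k"] by (simp add: uniformizer_def)
    moreover have "\<pp> ^ (k + e) dvd padic_exp (\<pp> ^ k * w) - 1 - \<pp> ^ k * w"
      by (rule power_le_dvd[OF padic_exp_linear[OF w, of k]]) (simp add: k_def)
    ultimately have "\<pp> ^ (k + e) dvd (padic_exp (\<pp> ^ k * w) - 1 - \<pp> ^ k * w) -
        (padic_exp (\<pp> ^ k * w) - 1 - \<pp> ^ k * padic_log (padic_exp w))"
      by (metis dvd_diff)
    also have "\<dots> = \<pp> ^ k * (padic_log (padic_exp w) - w)" by (simp add: algebra_simps)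
    finally show ?thesis by (simp add: power_add)
  qed
  then have "padic_log (padic_exp w) - w = 0" by (rule uniformizer_power_dvd_imp_eq_0)
  then show ?thesis by simp
qed

text \<open>
  With \<open>A = s^q - 1\<close> and \<open>B = t^q - 1\<close>, for \<open>q = p^k\<close>, the relation \<open>(1 + A) (1 + B) = 1\<close> gives
  \<open>A + B = - A B\<close>, which is divisible by \<open>p^(2k)\<close>, while the limit formula compares \<open>A + B\<close> with
  \<open>p^k (log s + log t)\<close>.
\<close>

lemma padic_log_inverse:
  fixes s t :: "'p padic_int"
  assumes s: "\<pp> dvd s - 1" and t: "\<pp> dvd t - 1" and st: "s * t = 1"
  shows "padic_log s + padic_log t = 0"
proof (rule uniformizer_power_dvd_imp_eq_0)
  fix e :: nat
  define k where "k = 3 * e"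
  define A where "A = s ^ (CARD('p) ^ k) - 1"
  define B where "B = t ^ (CARD('p) ^ k) - 1"
  have A: "\<pp> ^ (k + e) dvd A - \<pp> ^ k * padic_log s"
    unfolding A_def by (rule padic_log_limit[OF s]) (simp add: k_def)
  have B: "\<pp> ^ (k + e) dvd B - \<pp> ^ k * padic_log t"
    unfolding B_def by (rule padic_log_limit[OF t]) (simp add: k_def)
  have "\<pp> ^ k dvd A - \<pp> ^ k * padic_log s" "\<pp> ^ k dvd B - \<pp> ^ k * padic_log t"
    using power_le_dvd[OF A] power_le_dvd[OF B] by simp_all
  then have "\<pp> ^ k dvd A" "\<pp> ^ k dvd B"
    by (metis dvd_diffD1 dvd_triv_left dvd_add_right_iff diff_add_cancel dvd_add)+
  then have "\<pp> ^ (k + k) dvd A * B" unfolding power_add by (rule mult_dvd_mono)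
  then have AB: "\<pp> ^ (k + e) dvd A * B" by (rule power_le_dvd) (simp add: k_def)
  have "(1 + A) * (1 + B) = 1" by (simp add: A_def B_def power_mult_distrib[symmetric] st)
  then have "A + B + A * B = 0" by (simp add: algebra_simps)
  then have eq: "A * B + (A - \<pp> ^ k * padic_log s) + (B - \<pp> ^ k * padic_log t) =
      - (\<pp> ^ k * (padic_log s + padic_log t))" by (simp add: algebra_simps)
  have "\<pp> ^ (k + e) dvd - (\<pp> ^ k * (padic_log s + padic_log t))"
    unfolding eq[symmetric] by (intro dvd_add A B AB)
  then show "\<pp> ^ e dvd padic_log s + padic_log t" by (simp add: power_add)
qed

text \<open>
  This puts \<open>z log s\<close> into the domain \<open>p\<int>\<^sub>p\<close> of the exponential. It follows from the limit formula with
  \<open>e = 1\<close> and \<open>k = 3\<close>, since \<open>s^(p^3) - 1\<close> is divisible by \<open>p^4\<close>.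
\<close>

lemma uniformizer_dvd_padic_log:
  fixes s :: "'p padic_int"
  assumes s: "\<pp> dvd s - 1"
  shows "\<pp> dvd padic_log s"
proof -
  obtain w where w: "s ^ (CARD('p) ^ 3) - 1 = of_nat (CARD('p) ^ 3) * (s - 1) * w"
    using lifting_the_exponent[OF odd s] by blast
  have "\<pp> ^ 3 * \<pp> dvd \<pp> ^ 3 * ((s - 1) * w)" using s by (intro mult_dvd_mono) auto
  also have "\<pp> ^ 3 * ((s - 1) * w) = s ^ (CARD('p) ^ 3) - 1"
    by (simp only: w of_nat_power uniformizer_def mult.assoc)
  finally have 1: "\<pp> ^ 3 * \<pp> dvd s ^ (CARD('p) ^ 3) - 1" .
  have 2: "\<pp> ^ 3 * \<pp> dvd s ^ (CARD('p) ^ 3) - 1 - \<pp> ^ 3 * padic_log s"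
    using padic_log_limit[OF s, of 1 3] by (simp only: power_add power_one_right)
  have "\<pp> ^ 3 * \<pp> dvd \<pp> ^ 3 * padic_log s" using dvd_diff[OF 1 2] by simp
  then show ?thesis by simp
qed

end

lemma padic_log_1: "padic_log (1 :: 'p::prime_card padic_int) = 0"
  by (simp add: padic_log_def)

section \<open>Solutions in the p-adic integers\<close>

lemma teichmuller_eq:
  fixes a x :: "'p::prime_card padic_int"
  assumes odd: "CARD('p) \<noteq> 2" and a: "root_of_unity a" and xa: "\<pp> dvd x - a"
  shows "teichmuller x = a"
  unfolding teichmuller_def
proof (rule the_equality)
  have "\<pp> dvd a - x" using xa dvd_minus_iff[of \<pp> "x - a"] by simp
  then show "a ^ (CARD('p) - 1) = 1 \<and> of_nat CARD('p) dvd a - x"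
    using root_of_unity_power_eq_1[OF odd a] by (simp add: uniformizer_def)
next
  fix w :: "'p padic_int"
  assume w: "w ^ (CARD('p) - 1) = 1 \<and> of_nat CARD('p) dvd w - x"
  then have "\<pp> dvd w - x" by (simp add: uniformizer_def)
  from dvd_add[OF this xa] have "\<pp> dvd w - a" by simp
  then show "w = a"
    using roots_of_unity_congruent_imp_eq[OF odd _ _ root_of_unity_power_eq_1[OF odd a], of w] w
      card_gt_1[where 'p='p] by auto
qed

lemma padic_angle_decomposition:
  fixes a x :: "'p::prime_card padic_int"
  assumes odd: "CARD('p) \<noteq> 2" and a: "root_of_unity a" and xa: "\<pp> dvd x - a"
  shows "x = a * padic_angle x" and "\<pp> dvd padic_angle x - 1"
proof -
  have a_unit: "\<not> \<pp> dvd a" by (rule root_of_unity_not_uniformizer_dvd[OF a])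
  have "a dvd x" using not_uniformizer_dvd_imp_unit[OF a_unit] by (rule unit_imp_dvd)
  then show x: "x = a * padic_angle x" by (simp add: padic_angle_def teichmuller_eq[OF odd a xa])
  have "\<pp> dvd a * (padic_angle x - 1)" using xa x by (simp add: right_diff_distrib)
  then show "\<pp> dvd padic_angle x - 1" using a_unit by (simp add: uniformizer_dvd_mult_iff)
qed

text \<open>
  Taking logarithms, \<open>u = log s\<close> and \<open>v = log t\<close> satisfy \<open>v = x^n u\<close> and \<open>u = y^n v\<close>. If \<open>u\<close> were
  nonzero, then \<open>(st)^n = (xy)^n = 1\<close>, so \<open>st = 1\<close>, so \<open>v = -u\<close> and \<open>x^n = -1\<close>, which makes \<open>s\<close> a root of
  unity and hence \<open>u = log 1 = 0\<close>.
\<close>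

lemma exp_log_fixed_point_trivial:
  fixes s t x y :: "'p::prime_card padic_int"
  assumes odd: "CARD('p) \<noteq> 2" and n: "n > 0" and c: "c ^ (CARD('p) - 1) = 1" "c * d = 1"
    and s: "\<pp> dvd s - 1" and t: "\<pp> dvd t - 1"
    and xs: "x ^ n = c * s ^ n" and yt: "y ^ n = d * t ^ n"
    and ts: "t = padic_exp (x ^ n * padic_log s)" and st: "s = padic_exp (y ^ n * padic_log t)"
  shows "s = 1 \<and> t = 1"
proof -
  let ?u = "padic_log s" and ?v = "padic_log t"
  have u: "\<pp> dvd ?u" and v: "\<pp> dvd ?v"
    by (rule uniformizer_dvd_padic_log[OF odd s], rule uniformizer_dvd_padic_log[OF odd t])
  have vu: "?v = x ^ n * ?u" by (subst ts) (rule padic_log_exp[OF odd dvd_mult[OF u]])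
  have uv: "?u = y ^ n * ?v" by (subst st) (rule padic_log_exp[OF odd dvd_mult[OF v]])
  have "x ^ n * y ^ n = (c * d) * (s * t) ^ n"
    by (simp only: xs yt power_mult_distrib mult_ac)
  then have xy: "x ^ n * y ^ n = (s * t) ^ n" by (simp add: c(2))
  have u_0: "?u = 0"
  proof (rule ccontr)
    assume u0: "?u \<noteq> 0"
    have "?u = (x ^ n * y ^ n) * ?u" using uv unfolding vu by (simp add: mult_ac)
    then have st_n: "(s * t) ^ n = 1" using u0 by (simp add: xy)
    have "\<pp> dvd s * (t - 1) + (s - 1)" using s t by (intro dvd_add dvd_mult)
    then have "\<pp> dvd s * t - 1" by (simp add: algebra_simps)
    then have st1: "s * t = 1" by (rule one_units_torsion_free[OF odd _ n st_n])
    have "?u + ?v = 0" by (rule padic_log_inverse[OF odd s t st1])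
    then have "?u * (1 + x ^ n) = 0" by (simp add: vu algebra_simps)
    then have "x ^ n = - 1" using u0 by (simp add: add_eq_0_iff)
    then have cs: "c * s ^ n = - 1" by (simp add: xs)
    have "odd CARD('p)"
      using odd prime_card[where 'a='p] prime_odd_nat prime_ge_2_nat le_neq_implies_less by metis
    then have "(c * s ^ n) ^ (CARD('p) - 1) = 1" unfolding cs by simp
    then have "s ^ (n * (CARD('p) - 1)) = 1" by (simp only: power_mult_distrib c(1) power_mult mult_1_left)
    then have "s = 1"
      using n card_gt_1[where 'p='p] by (intro one_units_torsion_free[OF odd s, of "n * (CARD('p) - 1)"]) auto
    then show False using u0 by (simp add: padic_log_1)
  qed
  have v_0: "?v = 0" by (simp only: vu u_0 mult_zero_right)
  have "t = 1" by (subst ts) (simp add: u_0 padic_exp_0[OF odd])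
  moreover have "s = 1" by (subst st) (simp add: v_0 padic_exp_0[OF odd])
  ultimately show ?thesis by blast
qed

text \<open>
  The exponential takes values in \<open>1 + p\<int>\<^sub>p\<close>, so modulo \<open>p\<close> the equations give \<open>a^(i^n) = b\<close> and
  \<open>b^(j^n) = a\<close>. Once these are cancelled, \<open>\<langle>x\<rangle>\<close> and \<open>\<langle>y\<rangle>\<close> are as in \<open>exp_log_fixed_point_trivial\<close>,
  hence both equal to \<open>1\<close>.
\<close>

lemma T_inf_eq:
  fixes a b :: "'p::prime_card padic_int"
  assumes odd: "CARD('p) \<noteq> 2" and n: "n > 0"
    and a: "root_of_unity a" and b: "root_of_unity b" and ab: "a ^ n * b ^ n = 1"
  shows "T_inf n a b = {a} \<times> {b} \<times> exponent_pairs n a b"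
proof -
  let ?q = "CARD('p) - 1"
  have q: "?q > 0" using card_gt_1[where 'p='p] by simp
  have aq: "a ^ ?q = 1" and bq: "b ^ ?q = 1"
    by (rule root_of_unity_power_eq_1[OF odd a], rule root_of_unity_power_eq_1[OF odd b])
  \<comment> \<open>A product of a root of unity and a one-unit has the root of unity as its Teichmueller part.\<close>
  have root_eq: "f ^ k = g"
    if "f ^ ?q = 1" "g ^ ?q = 1" "\<pp> dvd r - 1" "\<pp> dvd h - g" "f ^ k * r = h" for f g h r :: "'p padic_int" and k
  proof (rule roots_of_unity_congruent_imp_eq[OF odd q _ that(2)])
    show "(f ^ k) ^ ?q = 1" by (metis that(1) power_mult mult.commute power_one)
    show "\<pp> dvd f ^ k - g"
      using dvd_diff[OF that(4) dvd_mult[OF that(3), of "f ^ k"]]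
      by (simp add: that(5)[symmetric] right_diff_distrib)
  qed
  have trivial: "(x, y, i, j) \<in> T_inf n a b \<longleftrightarrow> x = a \<and> y = b \<and> (i, j) \<in> exponent_pairs n a b" for x y i j
  proof
    assume "(x, y, i, j) \<in> T_inf n a b"
    then have ij: "i \<in> {1..?q}" "j \<in> {1..?q}" and xa: "\<pp> dvd x - a" and yb: "\<pp> dvd y - b"
      and xy: "teichmuller x ^ (i ^ n) * padic_angle_pow x (x ^ n) = y"
      and yx: "teichmuller y ^ (j ^ n) * padic_angle_pow y (y ^ n) = x"
      by (auto simp: T_inf_def uniformizer_def)
    define s where "s = padic_angle x"
    define t where "t = padic_angle y"
    have s: "x = a * s" "\<pp> dvd s - 1" and t: "y = b * t" "\<pp> dvd t - 1"
      unfolding s_def t_def using padic_angle_decomposition[OF odd a xa] padic_angle_decomposition[OF odd b yb] by blast+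
    define t' where "t' = padic_exp (x ^ n * padic_log s)"
    define s' where "s' = padic_exp (y ^ n * padic_log t)"
    have s': "\<pp> dvd s' - 1" and t': "\<pp> dvd t' - 1"
      unfolding s'_def t'_def using uniformizer_dvd_padic_log[OF odd] s(2) t(2)
      by (blast intro: uniformizer_dvd_padic_exp_minus_1[OF odd] dvd_mult)+
    have xy': "a ^ (i ^ n) * t' = y" and yx': "b ^ (j ^ n) * s' = x"
      using xy yx by (simp_all add: padic_angle_pow_def t'_def s'_def s_def t_def
          teichmuller_eq[OF odd a xa] teichmuller_eq[OF odd b yb])
    have ai: "a ^ (i ^ n) = b" by (rule root_eq[OF aq bq t' yb xy'])
    have bj: "b ^ (j ^ n) = a" by (rule root_eq[OF bq aq s' xa yx'])
    have nz: "a \<noteq> 0" "b \<noteq> 0" using aq bq q by (auto simp: power_0_left)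
    have "t = t'" "s = s'" using xy' yx' nz by (simp_all add: ai bj s(1) t(1))
    then have ts: "t = padic_exp (x ^ n * padic_log s)" "s = padic_exp (y ^ n * padic_log t)"
      by (simp_all only: t'_def s'_def)
    have "(a ^ n) ^ ?q = 1" by (metis aq power_mult mult.commute power_one)
    moreover have "x ^ n = a ^ n * s ^ n" "y ^ n = b ^ n * t ^ n"
      by (simp_all only: s(1) t(1) power_mult_distrib)
    ultimately have "s = 1 \<and> t = 1"
      using exp_log_fixed_point_trivial[OF odd n _ ab s(2) t(2)] ts by blast
    then show "x = a \<and> y = b \<and> (i, j) \<in> exponent_pairs n a b"
      using s(1) t(1) ij ai bj by (simp add: exponent_pairs_def)
  next
    assume R: "x = a \<and> y = b \<and> (i, j) \<in> exponent_pairs n a b"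
    have "padic_angle_pow c z = 1" if c: "root_of_unity c" for c z :: "'p padic_int"
    proof -
      have "c = c * padic_angle c" using padic_angle_decomposition(1)[OF odd c] by simp
      moreover have "c \<noteq> 0" using c by (auto simp: root_of_unity_def power_0_left)
      ultimately have "padic_angle c = 1" by simp
      then show ?thesis by (simp add: padic_angle_pow_def padic_log_1 padic_exp_0[OF odd])
    qed
    moreover have "teichmuller a = a" "teichmuller b = b"
      using teichmuller_eq[OF odd a] teichmuller_eq[OF odd b] by simp_all
    ultimately show "(x, y, i, j) \<in> T_inf n a b"
      using R a b root_of_unity_not_uniformizer_dvd[OF a] root_of_unity_not_uniformizer_dvd[OF b]
      by (simp add: T_inf_def exponent_pairs_def uniformizer_def)
  qed
  show ?thesis
  proof (rule Set.set_eqI)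
    show "w \<in> T_inf n a b \<longleftrightarrow> w \<in> {a} \<times> {b} \<times> exponent_pairs n a b" for w
      by (cases w) (simp add: trivial)
  qed
qed

theorem theorem16:
  fixes a b :: "'p::prime_card padic_int" and p n :: nat
  assumes "p = CARD('p)" and "p \<noteq> 2" and "n > 0"
    and "root_of_unity a" and "root_of_unity b"
    and "b ^ n = 1 div a ^ n"
  shows "(\<forall>e\<ge>1. card (T_fin n a b e) = card (T_fin n a b 1) *
           (if b ^ n \<noteq> - 1 then
              if e \<le> multiplicity p n then p ^ (e - 1)
              else p ^ ((e + multiplicity p n) div 2)
            else
              if e \<le> 2 * multiplicity p n then p ^ (e - 1)
              else p ^ ((e + multiplicity p n) div 3 + (e + multiplicity p n + 1) div 3)))
         \<and> finite (T_inf n a b) \<and> card (T_inf n a b) = card (T_fin n a b 1)"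
proof -
  let ?E = "exponent_pairs n a b" and ?N = "multiplicity p n"
  have p: "p = CARD('p)" and odd: "CARD('p) \<noteq> 2" and n: "n > 0"
    and a: "root_of_unity a" and b: "root_of_unity b"
    using assms by simp_all
  have "is_unit (a ^ n)"
    using root_of_unity_not_uniformizer_dvd[OF a]
    by (intro not_uniformizer_dvd_imp_unit) (simp add: uniformizer_dvd_power_iff)
  then have ab: "a ^ n * b ^ n = 1" unfolding assms(6) by (rule unit_imp_dvd[THEN dvd_mult_div_cancel])
  have card: "card (T_fin n a b e) =
      card ?E * p ^ (e - congruence_depth ?N (b ^ n = - 1) e)" if "e \<ge> 1" for e
    unfolding p by (rule card_T_fin[OF odd n that a b ab])
  have card1: "card (T_fin n a b 1) = card ?E"
    using card[of 1] congruence_depth_bounds[of 1 ?N "b ^ n = - 1"] by simp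
  have fin: "card (T_fin n a b e) = card (T_fin n a b 1) *
           (if b ^ n \<noteq> - 1 then
              if e \<le> ?N then p ^ (e - 1)
              else p ^ ((e + ?N) div 2)
            else
              if e \<le> 2 * ?N then p ^ (e - 1)
              else p ^ ((e + ?N) div 3 + (e + ?N + 1) div 3))" if "e \<ge> 1" for e
    unfolding card1 card[OF that] minus_congruence_depth[OF that] by (simp only: if_distrib[of "(^) p"])
  have "T_inf n a b = {a} \<times> {b} \<times> ?E" by (rule T_inf_eq[OF odd n a b ab])
  then have "finite (T_inf n a b) \<and> card (T_inf n a b) = card (T_fin n a b 1)"
    using finite_exponent_pairs[of n a b] by (simp add: card_cartesian_product card1[unfolded One_nat_def])
  then show ?thesis using fin by blast
qed

end
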